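(* Let $X^\theta$ ($\theta\in\Theta$), $L$, the time grid, $\varepsilon\in(0,1/2)$, $v_n=\Delta_n^{1/2-\varepsilon}$ and the events $N_n^i$, $A_n^i$ be as described in the context. Assume: (1) $\sigma,\gamma$ and, for every $\theta\in\Theta$, $b(\theta,\cdot)$ are globally Lipschitz, the Lipschitz constant of $b(\theta,\cdot)$ being bounded uniformly over $\theta\in\Theta$; (2) for every $\theta\in\Theta$ there is $t>0$ such that $X^\theta_t$ started from $x$ has a Lebesgue density $p^\theta_t(x,y)$ which is bounded in $y\in\mathbb R$, $x\in K$, for every compact $K\subset\mathbb R$; moreover for every $x\in\mathbb R$ and every open ball $U\subset\mathbb R$ there is $z\in\operatorname{supp}(\nu)$ with $\gamma(x)z\in U$; (3) (i) $\int_{|z|>1}|z|^q\nu(dz)<\infty$ for all $q>0$; (ii) for every $\theta\in\Theta$ there is $C>0$ such that $x\,b(\theta,x)\le -C|x|^2$ for all $|x|$ large enough; (iii) $|\gamma(x)|/|x|\to0$ and (iv) $|\sigma(x)|/|x|\to 0$ as $|x|\to\infty$; (v) $E|X_0^\theta|^q<\infty$ for all $\theta\in\Theta$, $q>0$; (4) (i) $\gamma_{\min}:=\inf_{x}|\gamma(x)|\ge 1$; (ii) $\int_{0<|z|\le1}|z|\nu(dz)<\infty$; (iii) $\nu$ is absolutely continuous with respect to Lebesgue measure; (iv) $\gamma_{\max}:=\sup_x|\gamma(x)|<\infty$. Then there is a constant $C>0$ (independent of $n$ and $i$) such that $$P\big((N_n^i)^c\cap(A_n^i)^c\big)\le C\,\frac{\Delta_n^2}{v_n}\int_{|z|\ge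 3v_n/\gamma_{\min}}\nu(dz).$$
   Context: Model. $\Theta\subset\mathbb R^d$ is compact; $b:\Theta\times\mathbb R\to\mathbb R$, $\sigma,\gamma:\mathbb R\to\mathbb R$. For $\theta\in\Theta$, $X^\theta$ solves $$X^\theta_t=X^\theta_0+\int_0^t b(\theta,X^\theta_s)\,ds+\int_0^t\sigma(X^\theta_s)\,dW_s+\int_0^t\int_{\mathbb R}\gamma(X^\theta_{s-})\,z\,\mu(ds,dz),\quad t\ge0,$$ where $W$ is a one-dimensional Brownian motion and $\mu$ is the Poisson random measure on $[0,\infty)\times\mathbb R$ with intensity $ds\,\nu(dz)$ associated with the jumps of the pure jump Lévy process $L_t=\int_0^t\int_{\mathbb R}z\,\mu(ds,dz)$, with Lévy measure $\nu$ satisfying $\int_{\mathbb R}|z|\nu(dz)<\infty$. $X^\theta_0$, $W$, $L$ are independent. For each $n$, $0=t_0\le t_1\le\dots\le t_n$ are deterministic times (depending on $n$), with $\Delta_n:=\sup_{i}(t_{i+1}-t_i)\to0$ and $t_n\to\infty$, $n\Delta_n=O(t_n)$. Fix $\varepsilon\in(0,1/2)$ and set $v_n=\Delta_n^{1/2-\varepsilon}$. Events. Write $\Delta L_s=L_s-L_{s-}$. Let $$N_n^i=\{|\Delta L_s|\le 3v_n/\gamma_{\min}\ \ \forall s\in(t_{i-1},t_i]\}.$$ Let $T_i^*\in(t_{i-1},t_i]$ be the (almost surely unique, since $\nu$ has a density, whenever $L$ jumps in the interval) time with $|\Delta L_{T_i^*}|=\max\{|\Delta L_s|: s\in(t_{i-1},t_i]\}$,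 and let $$A_n^i=\Big\{\sum_{t_{i-1}<s\le t_i,\ s\ne T_i^*}|\Delta L_s|\le\frac{v_n}{\gamma_{\max}}\Big\}.$$ *)

theory Defs
  imports "HOL-Probability.Probability"
begin

text \<open>Time is modelled by \<^typ>\<open>real\<close>; processes are only used at times \<open>\<ge> 0\<close>. A process is a
  function of time and of the sample point.\<close>

definition cadlag :: "(real \<Rightarrow> real) \<Rightarrow> bool" where
  "cadlag f \<longleftrightarrow> (\<forall>s\<ge>0. (f \<longlongrightarrow> f s) (at_right s)) \<and> (\<forall>s>0. \<exists>l. (f \<longlongrightarrow> l) (at_left s))"

definition left_limit :: "(real \<Rightarrow> real) \<Rightarrow> real \<Rightarrow> real" where
  "left_limit f s = Lim (at_left s) f"

definition jump :: "(real \<Rightarrow> 'w \<Rightarrow> real) \<Rightarrow> real \<Rightarrow> 'w \<Rightarrow> real" where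
  "jump L s \<omega> = L s \<omega> - left_limit (\<lambda>r. L r \<omega>) s"

text \<open>The counting measure of the points \<open>(s, \<Delta>L\<^sub>s)\<close>, where \<open>s > 0\<close> runs over the jump times
  of the path.\<close>

definition jump_measure :: "(real \<Rightarrow> 'w \<Rightarrow> real) \<Rightarrow> 'w \<Rightarrow> (real \<times> real) measure" where
  "jump_measure L \<omega> =
     distr (count_space {s. 0 < s \<and> jump L s \<omega> \<noteq> 0}) (borel \<Otimes>\<^sub>M borel) (\<lambda>s. (s, jump L s \<omega>))"

definition path_algebra :: "'w measure \<Rightarrow> real set \<Rightarrow> (real \<Rightarrow> 'w \<Rightarrow> real) \<Rightarrow> 'w set set" where
  "path_algebra M T Z =
     sets (vimage_algebra (space M) (\<lambda>\<omega>. \<lambda>s\<in>T. Z s \<omega>) (\<Pi>\<^sub>M s\<in>T. borel))"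

definition var_algebra :: "'w measure \<Rightarrow> ('w \<Rightarrow> real) \<Rightarrow> 'w set set" where
  "var_algebra M Y = sets (vimage_algebra (space M) Y borel)"

definition independent_increments :: "'w measure \<Rightarrow> (real \<Rightarrow> 'w \<Rightarrow> real) \<Rightarrow> bool" where
  "independent_increments M Z \<longleftrightarrow>
     (\<forall>s\<ge>0. \<forall>t\<ge>s. prob_space.indep_set M (path_algebra M {0..s} Z)
        (var_algebra M (\<lambda>\<omega>. Z t \<omega> - Z s \<omega>)))"

definition brownian_motion :: "'w measure \<Rightarrow> (real \<Rightarrow> 'w \<Rightarrow> real) \<Rightarrow> bool" where
  "brownian_motion M W \<longleftrightarrow>
     (\<forall>s\<ge>0. W s \<in> borel_measurable M) \<and>
     (AE \<omega> in M. W 0 \<omega> = 0) \<and>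
     (\<forall>\<omega>\<in>space M. continuous_on {0..} (\<lambda>s. W s \<omega>)) \<and>
     independent_increments M W \<and>
     (\<forall>s\<ge>0. \<forall>t>s. distributed M lborel (\<lambda>\<omega>. W t \<omega> - W s \<omega>) (normal_density 0 (sqrt (t - s))))"

definition levy_process :: "'w measure \<Rightarrow> (real \<Rightarrow> 'w \<Rightarrow> real) \<Rightarrow> bool" where
  "levy_process M L \<longleftrightarrow>
     (\<forall>s\<ge>0. L s \<in> borel_measurable M) \<and>
     (AE \<omega> in M. L 0 \<omega> = 0) \<and>
     (\<forall>\<omega>\<in>space M. cadlag (\<lambda>s. L s \<omega>)) \<and>
     independent_increments M L \<and>
     (\<forall>s\<ge>0. \<forall>h\<ge>0. distr M borel (\<lambda>\<omega>. L (s + h) \<omega> - L s \<omega>) = distr M borel (L h))"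

definition levy_measure :: "real measure \<Rightarrow> bool" where
  "levy_measure \<nu> \<longleftrightarrow> sets \<nu> = sets borel \<and> emeasure \<nu> {0} = 0 \<and>
     (\<integral>\<^sup>+ z. ennreal (min 1 (z\<^sup>2)) \<partial>\<nu>) < \<infinity>"

definition poisson_random_measure :: "'w measure \<Rightarrow> ('w \<Rightarrow> 'e measure) \<Rightarrow> 'e measure \<Rightarrow> bool" where
  "poisson_random_measure M \<mu> \<Lambda> \<longleftrightarrow>
     (\<forall>\<omega>\<in>space M. sets (\<mu> \<omega>) = sets \<Lambda>) \<and>
     (\<forall>B\<in>sets \<Lambda>. (\<lambda>\<omega>. emeasure (\<mu> \<omega>) B) \<in> borel_measurable M) \<and>
     (\<forall>B\<in>sets \<Lambda>. emeasure \<Lambda> B < \<infinity> \<longrightarrow>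
        (\<forall>k::nat. measure M {\<omega>\<in>space M. emeasure (\<mu> \<omega>) B = of_nat k} =
           measure \<Lambda> B ^ k / fact k * exp (- measure \<Lambda> B))) \<and>
     (\<forall>B\<in>sets \<Lambda>. emeasure \<Lambda> B = \<infinity> \<longrightarrow> (AE \<omega> in M. emeasure (\<mu> \<omega>) B = \<infinity>)) \<and>
     (\<forall>(I::nat set) B. finite I \<longrightarrow> B ` I \<subseteq> sets \<Lambda> \<longrightarrow> disjoint_family_on B I \<longrightarrow>
        prob_space.indep_vars M (\<lambda>_. borel) (\<lambda>i \<omega>. emeasure (\<mu> \<omega>) (B i)) I)"

definition jump_intensity :: "real measure \<Rightarrow> (real \<times> real) measure" where
  "jump_intensity \<nu> = density lborel (indicator {0..}) \<Otimes>\<^sub>M \<nu>"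

text \<open>A pure jump Levy process with summable jumps and Levy measure \<open>\<nu>\<close>: it is the sum
  of its jumps, and its jump measure is Poisson with intensity \<open>ds \<nu>(dz)\<close>.\<close>

definition pure_jump_levy :: "'w measure \<Rightarrow> real measure \<Rightarrow> (real \<Rightarrow> 'w \<Rightarrow> real) \<Rightarrow> bool" where
  "pure_jump_levy M \<nu> L \<longleftrightarrow>
     levy_process M L \<and> levy_measure \<nu> \<and>
     poisson_random_measure M (jump_measure L) (jump_intensity \<nu>) \<and>
     (AE \<omega> in M. \<forall>t\<ge>0.
        set_integrable (jump_measure L \<omega>) ({0<..t} \<times> UNIV) snd \<and>
        L t \<omega> = (LINT p:{0<..t} \<times> UNIV|jump_measure L \<omega>. snd p))"

definition independent_inputs ::
    "'w measure \<Rightarrow> ('w \<Rightarrow> real) \<Rightarrow> (real \<Rightarrow> 'w \<Rightarrow> real) \<Rightarrow> (real \<Rightarrow> 'w \<Rightarrow> real) \<Rightarrow> bool" where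
  "independent_inputs M X0 W L \<longleftrightarrow>
     prob_space.indep_sets M
       (\<lambda>k. [var_algebra M X0, path_algebra M {0..} W, path_algebra M {0..} L] ! k) {..<3}"

definition tends_in_prob :: "'w measure \<Rightarrow> (nat \<Rightarrow> 'w \<Rightarrow> ennreal) \<Rightarrow> bool" where
  "tends_in_prob M D \<longleftrightarrow> (\<forall>n. D n \<in> borel_measurable M) \<and>
     (\<forall>e>0. (\<lambda>n. measure M {\<omega>\<in>space M. ennreal e < D n \<omega>}) \<longlonglongrightarrow> 0)"

text \<open>Bounded simple predictable integrands
  \<open>(\<Sum>k<m. \<xi> k * indicator {s k<..s (Suc k)})\<close> with \<open>\<xi> k\<close> known at time \<open>s k\<close>.\<close>

definition simple_integrand ::
    "(real \<Rightarrow> 'w measure) \<Rightarrow> nat \<Rightarrow> (nat \<Rightarrow> real) \<Rightarrow> (nat \<Rightarrow> 'w \<Rightarrow> real) \<Rightarrow> bool" where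
  "simple_integrand F m s \<xi> \<longleftrightarrow>
     0 \<le> s 0 \<and> (\<forall>k<m. s k \<le> s (Suc k) \<and> \<xi> k \<in> borel_measurable (F (s k)) \<and>
     (\<exists>B. \<forall>\<omega>\<in>space (F (s k)). \<bar>\<xi> k \<omega>\<bar> \<le> B))"

definition simple_value ::
    "nat \<Rightarrow> (nat \<Rightarrow> real) \<Rightarrow> (nat \<Rightarrow> 'w \<Rightarrow> real) \<Rightarrow> real \<Rightarrow> 'w \<Rightarrow> real" where
  "simple_value m s \<xi> r \<omega> = (\<Sum>k<m. \<xi> k \<omega> * indicator {s k<..s (Suc k)} r)"

definition simple_integral ::
    "(real \<Rightarrow> 'w \<Rightarrow> real) \<Rightarrow> nat \<Rightarrow> (nat \<Rightarrow> real) \<Rightarrow> (nat \<Rightarrow> 'w \<Rightarrow> real) \<Rightarrow> real \<Rightarrow> 'w \<Rightarrow> real" where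
  "simple_integral W m s \<xi> t \<omega> =
     (\<Sum>k<m. \<xi> k \<omega> * (W (min t (s (Suc k))) \<omega> - W (min t (s k)) \<omega>))"

definition progressive :: "(real \<Rightarrow> 'w measure) \<Rightarrow> (real \<Rightarrow> 'w \<Rightarrow> real) \<Rightarrow> bool" where
  "progressive F H \<longleftrightarrow>
     (\<forall>t\<ge>0. (\<lambda>p. H (fst p) (snd p)) \<in> borel_measurable (restrict_space borel {0..t} \<Otimes>\<^sub>M F t))"

text \<open>\<open>J\<close> is a continuous version of \<open>\<integral> H dW\<close> for a progressive \<open>H\<close> that is a.s. locally
  square integrable in time: the limit in probability of the integrals of simple integrands
  that approximate \<open>H\<close> in the sense that \<open>\<integral>\<^sub>0\<^sup>t (H\<^sup>n - H)\<^sup>2 ds\<close> tends to 0 in probability.\<close>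

definition ito_integral ::
    "'w measure \<Rightarrow> (real \<Rightarrow> 'w measure) \<Rightarrow> (real \<Rightarrow> 'w \<Rightarrow> real) \<Rightarrow> (real \<Rightarrow> 'w \<Rightarrow> real) \<Rightarrow>
     (real \<Rightarrow> 'w \<Rightarrow> real) \<Rightarrow> bool" where
  "ito_integral M F W H J \<longleftrightarrow>
     progressive F H \<and>
     (AE \<omega> in M. \<forall>t\<ge>0. (\<integral>\<^sup>+ r\<in>{0..t}. ennreal ((H r \<omega>)\<^sup>2) \<partial>lborel) < \<infinity>) \<and>
     (\<forall>t\<ge>0. J t \<in> borel_measurable (F t)) \<and>
     (\<forall>\<omega>\<in>space M. continuous_on {0..} (\<lambda>t. J t \<omega>)) \<and>
     (\<exists>(m::nat \<Rightarrow> nat) s \<xi>.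
        (\<forall>n. simple_integrand F (m n) (s n) (\<xi> n)) \<and>
        (\<forall>t\<ge>0.
           tends_in_prob M (\<lambda>n \<omega>. \<integral>\<^sup>+ r\<in>{0..t}.
             ennreal ((simple_value (m n) (s n) (\<xi> n) r \<omega> - H r \<omega>)\<^sup>2) \<partial>lborel) \<and>
           tends_in_prob M (\<lambda>n \<omega>.
             ennreal \<bar>simple_integral W (m n) (s n) (\<xi> n) t \<omega> - J t \<omega>\<bar>)))"

text \<open>The filtration generated by the initial value and the driving processes, augmented by the
  null sets.\<close>

definition driving_filtration ::
    "'w measure \<Rightarrow> ('w \<Rightarrow> real) \<Rightarrow> (real \<Rightarrow> 'w \<Rightarrow> real) \<Rightarrow> (real \<Rightarrow> 'w \<Rightarrow> real) \<Rightarrow>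
     real \<Rightarrow> 'w measure" where
  "driving_filtration M X0 W L t =
     sigma (space M)
       (var_algebra M X0 \<union> path_algebra M {0..t} W \<union> path_algebra M {0..t} L \<union> null_sets M)"

definition sde_solution ::
    "'w measure \<Rightarrow> (real \<Rightarrow> 'w \<Rightarrow> real) \<Rightarrow> (real \<Rightarrow> 'w \<Rightarrow> real) \<Rightarrow>
     (real \<Rightarrow> real) \<Rightarrow> (real \<Rightarrow> real) \<Rightarrow> (real \<Rightarrow> real) \<Rightarrow> (real \<Rightarrow> 'w \<Rightarrow> real) \<Rightarrow> bool" where
  "sde_solution M W L \<beta> \<sigma> \<gamma> X \<longleftrightarrow>
     X 0 \<in> borel_measurable M \<and>
     (\<forall>t\<ge>0. X t \<in> borel_measurable (driving_filtration M (X 0) W L t)) \<and>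
     (\<forall>\<omega>\<in>space M. cadlag (\<lambda>t. X t \<omega>)) \<and>
     (\<exists>J. ito_integral M (driving_filtration M (X 0) W L) W (\<lambda>s \<omega>. \<sigma> (X s \<omega>)) J \<and>
        (AE \<omega> in M. \<forall>t\<ge>0.
           set_integrable lborel {0..t} (\<lambda>s. \<beta> (X s \<omega>)) \<and>
           set_integrable (jump_measure L \<omega>) ({0<..t} \<times> UNIV)
             (\<lambda>(s, z). \<gamma> (left_limit (\<lambda>r. X r \<omega>) s) * z) \<and>
           X t \<omega> = X 0 \<omega> + (LINT s:{0..t}|lborel. \<beta> (X s \<omega>)) + J t \<omega> +
             (LINT p:{0<..t} \<times> UNIV|jump_measure L \<omega>.
                (case p of (s, z) \<Rightarrow> \<gamma> (left_limit (\<lambda>r. X r \<omega>) s) * z))))"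

definition measure_support :: "real measure \<Rightarrow> real set" where
  "measure_support \<nu> = {z. \<forall>U. open U \<longrightarrow> z \<in> U \<longrightarrow> emeasure \<nu> U > 0}"

definition no_large_jump :: "'w measure \<Rightarrow> (real \<Rightarrow> 'w \<Rightarrow> real) \<Rightarrow> real \<Rightarrow> real \<Rightarrow> real \<Rightarrow> 'w set" where
  "no_large_jump M L a b c = {\<omega>\<in>space M. \<forall>s\<in>{a<..b}. \<bar>jump L s \<omega>\<bar> \<le> c}"

text \<open>Several times may carry a jump of maximal size (in particular all times, if there is no jump
  at all); the sum over the other times below does not depend on which one is chosen.\<close>

definition max_jump_time :: "(real \<Rightarrow> 'w \<Rightarrow> real) \<Rightarrow> real \<Rightarrow> real \<Rightarrow> 'w \<Rightarrow> real" where
  "max_jump_time L a b \<omega> =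
     (SOME s. s \<in> {a<..b} \<and> (\<forall>r\<in>{a<..b}. \<bar>jump L r \<omega>\<bar> \<le> \<bar>jump L s \<omega>\<bar>))"

definition small_other_jumps ::
    "'w measure \<Rightarrow> (real \<Rightarrow> 'w \<Rightarrow> real) \<Rightarrow> real \<Rightarrow> real \<Rightarrow> real \<Rightarrow> 'w set" where
  "small_other_jumps M L a b c =
     {\<omega>\<in>space M.
        (\<Sum>\<^sub>\<infinity>s\<in>{a<..b} - {max_jump_time L a b \<omega>}. ennreal \<bar>jump L s \<omega>\<bar>) \<le> ennreal c}"

end

(* Let K be the number of jumps larger than u in the interval and Z the sum of the sizes of the
   remaining ones. If there is a jump larger than u and the jumps other than the largest one add up
   to more than c, then either K is at least 2, or K = 1, the largest jump is the only big one, and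
   Z > c. The first event has probability at most (E K)^2. For the second one, K and Z are
   independent, because big and small jumps are counted by a Poisson random measure on disjoint
   sets, so that Markov's inequality gives the bound P(K > 0) E Z / c.
   A cadlag path has only finitely many jumps larger than any given d > 0 in a bounded interval, so
   a jump of maximal size exists on every path, and the sum of the other jumps is the total sum
   minus the maximum; this makes the second event measurable without completing the space. *)

theory Submission
  imports Defs
begin

section \<open>Sums over uncountable sets of times, and the jump measure\<close>

text \<open>Bridges the counting integrals that come out of \<open>jump_measure\<close> and the
  unordered sum in \<open>small_other_jumps\<close>, whose index set is an uncountable interval of
  times. If the sum is finite, only finitely many values exceed \<open>1 / Suc n\<close>, and
  monotone convergence along these finite sets gives the nontrivial inequality.\<close>

lemma nn_integral_count_space_eq_infsum:
  fixes f :: "'a \<Rightarrow> ennreal"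
  shows "(\<integral>\<^sup>+x. f x \<partial>count_space A) = (\<Sum>\<^sub>\<infinity>x\<in>A. f x)"
proof (rule antisym)
  have S: "(\<Sum>\<^sub>\<infinity>x\<in>A. f x) = (SUP F\<in>{F. finite F \<and> F \<subseteq> A}. sum f F)"
    by (rule nonneg_infsum_complete) simp
  have sum_le: "sum f F \<le> (\<Sum>\<^sub>\<infinity>x\<in>A. f x)" if "finite F" "F \<subseteq> A" for F
    unfolding S using that by (intro SUP_upper) auto
  show "(\<Sum>\<^sub>\<infinity>x\<in>A. f x) \<le> (\<integral>\<^sup>+x. f x \<partial>count_space A)"
    unfolding S
  proof (rule SUP_least, clarsimp)
    fix F assume F: "finite F" "F \<subseteq> A"
    have "sum f F = (\<integral>\<^sup>+x. f x * indicator F x \<partial>count_space UNIV)"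
      using F by (simp add: nn_integral_count_space_finite flip: nn_integral_count_space_indicator)
    also have "\<dots> \<le> (\<integral>\<^sup>+x. f x * indicator A x \<partial>count_space UNIV)"
      using F by (intro nn_integral_mono) (auto split: split_indicator)
    finally show "sum f F \<le> (\<integral>\<^sup>+x. f x \<partial>count_space A)"
      by (simp add: nn_integral_count_space_indicator)
  qed
  show "(\<integral>\<^sup>+x. f x \<partial>count_space A) \<le> (\<Sum>\<^sub>\<infinity>x\<in>A. f x)"
  proof (cases "(\<Sum>\<^sub>\<infinity>x\<in>A. f x) = \<infinity>")
    case False
    define F where "F n = {x\<in>A. ennreal (1 / real (Suc n)) < f x}" for n
    have fin: "finite (F n)" for n
    proof (rule ccontr)
      \<comment> \<open>An infinite \<open>F n\<close> has finite subsets of every cardinality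
        \<open>k\<close>, so the sum would be at least \<open>k / Suc n\<close> for all
        \<open>k\<close>.\<close>
      assume inf: "infinite (F n)"
      have "of_nat k * ennreal (1 / real (Suc n)) \<le> (\<Sum>\<^sub>\<infinity>x\<in>A. f x)" for k
      proof -
        obtain G where G: "G \<subseteq> F n" "finite G" "card G = k"
          using inf infinite_arbitrarily_large by blast
        have "of_nat k * ennreal (1 / real (Suc n)) = (\<Sum>x\<in>G. ennreal (1 / real (Suc n)))"
          using G by simp
        also have "\<dots> \<le> sum f G"
          using G by (intro sum_mono) (auto simp: F_def)
        also have "\<dots> \<le> (\<Sum>\<^sub>\<infinity>x\<in>A. f x)"
          using G by (intro sum_le) (auto simp: F_def)
        finally show ?thesis .
      qed
      then have le: "(SUP k. of_nat k * ennreal (1 / real (Suc n))) \<le> (\<Sum>\<^sub>\<infinity>x\<in>A. f x)"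
        by (intro SUP_least)
      have "(SUP k. of_nat k * ennreal (1 / real (Suc n))) = (SUP k. of_nat k) * ennreal (1 / real (Suc n))"
        by (simp add: SUP_mult_right_ennreal)
      also have "\<dots> = \<infinity>"
        by (simp add: ennreal_SUP_of_nat_eq_top ennreal_top_mult)
      finally show False
        using le False by (metis top_unique infinity_ennreal_def)
    qed
    have inc: "incseq (\<lambda>n x. f x * indicator (F n) x)"
    proof (rule incseq_SucI, rule le_funI)
      fix n x
      have "ennreal (1 / real (Suc (Suc n))) \<le> ennreal (1 / real (Suc n))"
        by (intro ennreal_leI) (auto simp: field_simps)
      then have "F n \<subseteq> F (Suc n)"
        unfolding F_def by (blast intro: order.strict_trans1)
      then show "f x * indicator (F n) x \<le> f x * indicator (F (Suc n)) x"
        by (auto split: split_indicator)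
    qed
    \<comment> \<open>Each nonzero value passes the threshold of some \<open>F n\<close>, so the
      truncations recover \<open>f\<close> on \<open>A\<close>.\<close>
    have "(SUP n. f x * indicator (F n) x) = f x" if "x \<in> A" for x
    proof (rule antisym)
      show "(SUP n. f x * indicator (F n) x) \<le> f x"
        by (intro SUP_least) (auto split: split_indicator)
      show "f x \<le> (SUP n. f x * indicator (F n) x)"
      proof (cases "f x = 0")
        case False
        obtain n where "ennreal (1 / real (Suc n)) < f x"
        proof (cases "f x")
          case (real r)
          then have "0 < r" using False by (cases "r = 0") auto
          then obtain n where "1 / real (Suc n) < r"
            using reals_Archimedean by (auto simp: inverse_eq_divide)
          then show ?thesis using real that by (auto simp: ennreal_less_iff)
        next
          case top
          then show ?thesis using that[of 0] by simp
        qed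
        then have "f x = f x * indicator (F n) x"
          using \<open>x \<in> A\<close> by (auto simp: F_def)
        also have "\<dots> \<le> (SUP n. f x * indicator (F n) x)"
          by (rule SUP_upper) simp
        finally show ?thesis .
      qed simp
    qed
    then have "(\<integral>\<^sup>+x. f x \<partial>count_space A) = (\<integral>\<^sup>+x. (SUP n. f x * indicator (F n) x) \<partial>count_space A)"
      by (intro nn_integral_cong) auto
    also have "\<dots> = (SUP n. \<integral>\<^sup>+x. f x * indicator (F n) x \<partial>count_space A)"
      by (rule nn_integral_monotone_convergence_SUP[OF inc]) simp
    also have "\<dots> \<le> (\<Sum>\<^sub>\<infinity>x\<in>A. f x)"
    proof (rule SUP_least)
      fix n
      have "(\<integral>\<^sup>+x. f x * indicator (F n) x \<partial>count_space A) = (\<integral>\<^sup>+x. f x * indicator (F n) x \<partial>count_space (F n))"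
        by (rule nn_integral_count_space_eq) (auto simp: F_def)
      also have "\<dots> = sum f (F n)"
        by (simp add: nn_integral_count_space_finite[OF fin])
      also have "\<dots> \<le> (\<Sum>\<^sub>\<infinity>x\<in>A. f x)"
        using fin by (intro sum_le) (auto simp: F_def)
      finally show "(\<integral>\<^sup>+x. f x * indicator (F n) x \<partial>count_space A) \<le> (\<Sum>\<^sub>\<infinity>x\<in>A. f x)" .
    qed
    finally show ?thesis .
  qed simp
qed

lemma emeasure_jump_measure:
  assumes "B \<in> sets (borel \<Otimes>\<^sub>M borel)"
  shows "emeasure (jump_measure L \<omega>) B =
    emeasure (count_space UNIV) {s. 0 < s \<and> jump L s \<omega> \<noteq> 0 \<and> (s, jump L s \<omega>) \<in> B}"
proof -
  have eq: "(\<lambda>s. (s, jump L s \<omega>)) -` B \<inter> {s. 0 < s \<and> jump L s \<omega> \<noteq> 0} =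
      {s. 0 < s \<and> jump L s \<omega> \<noteq> 0 \<and> (s, jump L s \<omega>) \<in> B}"
    by auto
  have "emeasure (jump_measure L \<omega>) B = emeasure (count_space {s. 0 < s \<and> jump L s \<omega> \<noteq> 0})
      {s. 0 < s \<and> jump L s \<omega> \<noteq> 0 \<and> (s, jump L s \<omega>) \<in> B}"
    unfolding jump_measure_def using assms
    by (subst emeasure_distr) (auto simp: space_pair_measure eq)
  then show ?thesis
    by (simp add: emeasure_count_space subset_eq)
qed

text \<open>\<open>g 0 = 0\<close> lets the sum run over all of \<open>T\<close> although the
  measure charges only times that carry a jump; \<open>T\<close> lies in \<open>{0<..}\<close>
  because only positive times are charged.\<close>

lemma nn_integral_jump_measure:
  assumes "T \<in> sets borel" "T \<subseteq> {0<..}" and [measurable]: "g \<in> borel_measurable borel" and "g 0 = 0"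
  shows "(\<integral>\<^sup>+p. indicator T (fst p) * g (snd p) \<partial>jump_measure L \<omega>) = (\<Sum>\<^sub>\<infinity>s\<in>T. g (jump L s \<omega>))"
proof -
  have [measurable]: "T \<in> sets borel" by fact
  have "(\<integral>\<^sup>+p. indicator T (fst p) * g (snd p) \<partial>jump_measure L \<omega>) =
      (\<integral>\<^sup>+s. indicator T s * g (jump L s \<omega>) \<partial>count_space {s. 0 < s \<and> jump L s \<omega> \<noteq> 0})"
    unfolding jump_measure_def by (subst nn_integral_distr) (auto simp: space_pair_measure)
  also have "\<dots> = (\<integral>\<^sup>+s. indicator T s * g (jump L s \<omega>) \<partial>count_space T)"
    using assms by (intro nn_integral_count_space_eq) auto
  also have "\<dots> = (\<integral>\<^sup>+s. g (jump L s \<omega>) \<partial>count_space T)"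
    by (intro nn_integral_cong) auto
  finally show ?thesis
    by (simp add: nn_integral_count_space_eq_infsum)
qed

section \<open>Large jumps of cadlag paths\<close>

text \<open>Near a point \<open>z\<close> the path stays close to \<open>f z\<close> on the right
  and to its left limit on the left, so times of large jumps cannot accumulate at \<open>z\<close>.
  A subset of a compact interval that has no accumulation point there is finite.\<close>

lemma cadlag_finite_large_jumps:
  assumes f: "cadlag f" and "0 \<le> a" "0 < d"
  shows "finite {s\<in>{a<..b}. d < \<bar>f s - left_limit f s\<bar>}"
proof -
  define J where "J = {s\<in>{a<..b}. d < \<bar>f s - left_limit f s\<bar>}"
  have left: "(f \<longlongrightarrow> left_limit f s) (at_left s)" if "0 < s" for s
  proof -
    obtain l where l: "(f \<longlongrightarrow> l) (at_left s)"
      using f \<open>0 < s\<close> by (auto simp: cadlag_def)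
    then show ?thesis
      unfolding left_limit_def by (metis tendsto_Lim trivial_limit_at_left_real)
  qed
  \<comment> \<open>A single value \<open>l\<close> within \<open>d / 2\<close> of the path both at
    \<open>s\<close> and just before \<open>s\<close> forces the jump at \<open>s\<close> below
    \<open>d\<close>.\<close>
  have small: "s \<notin> J" if F: "\<forall>\<^sub>F r in at_left s. dist (f r) l < d / 2"
      and s: "dist (f s) l < d / 2" for s l
  proof
    assume "s \<in> J"
    then have "0 < s" using \<open>0 \<le> a\<close> by (auto simp: J_def)
    have "\<bar>left_limit f s - l\<bar> \<le> d / 2"
    proof (rule tendsto_upperbound[OF _ _ trivial_limit_at_left_real])
      show "((\<lambda>r. \<bar>f r - l\<bar>) \<longlongrightarrow> \<bar>left_limit f s - l\<bar>) (at_left s)"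
        by (intro tendsto_intros left \<open>0 < s\<close>)
      show "\<forall>\<^sub>F r in at_left s. \<bar>f r - l\<bar> \<le> d / 2"
        using F by eventually_elim (simp add: dist_real_def)
    qed
    moreover have "d < \<bar>f s - left_limit f s\<bar>" "\<bar>f s - l\<bar> < d / 2"
      using s \<open>s \<in> J\<close> by (auto simp: J_def dist_real_def)
    ultimately show False by linarith
  qed
  have "\<not> z islimpt J" if z: "z \<in> {a..b}" for z
  proof -
    have "(f \<longlongrightarrow> f z) (at_right z)"
      using f z \<open>0 \<le> a\<close> by (auto simp: cadlag_def)
    then have "\<forall>\<^sub>F r in at_right z. dist (f r) (f z) < d / 2"
      using \<open>0 < d\<close> by (intro tendstoD) auto
    then obtain c where c: "z < c" "\<And>r. z < r \<Longrightarrow> r < c \<Longrightarrow> dist (f r) (f z) < d / 2"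
      unfolding eventually_at_right_field by auto
    have right: "s \<notin> J" if "z < s" "s < c" for s
    proof (rule small[of "f z"])
      show "\<forall>\<^sub>F r in at_left s. dist (f r) (f z) < d / 2"
        unfolding eventually_at_left_field using that c by (intro exI[of _ z]) auto
      show "dist (f s) (f z) < d / 2" using that c by auto
    qed
    obtain e where e: "e < z" "\<And>s. e < s \<Longrightarrow> s < z \<Longrightarrow> s \<notin> J"
    \<comment> \<open>\<open>J\<close> has no points to the left of \<open>a\<close>. The case is
      separate because \<open>cadlag\<close> provides no left limit at time 0, and \<open>a\<close>
      may be 0.\<close>
    proof (cases "z = a")
      case True
      then show ?thesis using that[of "z - 1"] by (auto simp: J_def)
    next
      case False
      then have "0 < z" using z \<open>0 \<le> a\<close> by auto
      have "\<forall>\<^sub>F r in at_left z. dist (f r) (left_limit f z) < d / 2"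
        using \<open>0 < d\<close> by (intro tendstoD left \<open>0 < z\<close>) auto
      then obtain e where e: "e < z" "\<And>r. e < r \<Longrightarrow> r < z \<Longrightarrow> dist (f r) (left_limit f z) < d / 2"
        unfolding eventually_at_left_field by auto
      have "s \<notin> J" if "e < s" "s < z" for s
      proof (rule small[of "left_limit f z"])
        show "\<forall>\<^sub>F r in at_left s. dist (f r) (left_limit f z) < d / 2"
          unfolding eventually_at_left_field using that e by (intro exI[of _ e]) auto
        show "dist (f s) (left_limit f z) < d / 2" using that e by auto
      qed
      then show ?thesis using that e by blast
    qed
    have "\<forall>y\<in>J. y \<in> {e<..<c} \<longrightarrow> y = z"
      using right e by force
    moreover have "z \<in> {e<..<c}" "open {e<..<c}" using c e by auto
    ultimately show ?thesis
      unfolding islimpt_def by blast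
  qed
  then have "finite ({a..b} \<inter> J)"
    by (intro finite_not_islimpt_in_compact) auto
  moreover have "{a..b} \<inter> J = J" by (auto simp: J_def)
  ultimately show ?thesis by (simp add: J_def)
qed

text \<open>Supplies the witness for the choice in \<open>max_jump_time\<close>. Only finitely many
  jumps exceed half of a given nonzero jump, so there is a largest one among them; on an interval
  without jumps every time is maximal.\<close>

lemma cadlag_max_jump:
  assumes f: "cadlag (\<lambda>s. L s \<omega>)" and "0 \<le> a" "a < b"
  shows "max_jump_time L a b \<omega> \<in> {a<..b}" 
    "\<And>r. r \<in> {a<..b} \<Longrightarrow> \<bar>jump L r \<omega>\<bar> \<le> \<bar>jump L (max_jump_time L a b \<omega>) \<omega>\<bar>"
proof -
  have "\<exists>s. s \<in> {a<..b} \<and> (\<forall>r\<in>{a<..b}. \<bar>jump L r \<omega>\<bar> \<le> \<bar>jump L s \<omega>\<bar>)"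
  proof (cases "\<exists>s\<in>{a<..b}. jump L s \<omega> \<noteq> 0")
    case False
    then show ?thesis using \<open>a < b\<close> by (intro exI[of _ b]) auto
  next
    case True
    then obtain s0 where s0: "s0 \<in> {a<..b}" "jump L s0 \<omega> \<noteq> 0" by auto
    \<comment> \<open>Halving keeps \<open>s0\<close> itself in \<open>J\<close>, while every time
      outside \<open>J\<close> has a smaller jump than \<open>s0\<close>.\<close>
    define J where "J = {s\<in>{a<..b}. \<bar>jump L s0 \<omega>\<bar> / 2 < \<bar>jump L s \<omega>\<bar>}"
    have fin: "finite J"
      unfolding J_def jump_def
      by (rule cadlag_finite_large_jumps[OF f \<open>0 \<le> a\<close>]) (use s0 in \<open>auto simp: jump_def\<close>)
    have "s0 \<in> J" using s0 by (auto simp: J_def)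
    obtain s where s: "s \<in> J" "\<forall>r\<in>J. \<bar>jump L r \<omega>\<bar> \<le> \<bar>jump L s \<omega>\<bar>"
    proof -
      have "Max ((\<lambda>s. \<bar>jump L s \<omega>\<bar>) ` J) \<in> (\<lambda>s. \<bar>jump L s \<omega>\<bar>) ` J"
        using fin \<open>s0 \<in> J\<close> by (intro Max_in) auto
      then obtain s where s: "s \<in> J" "Max ((\<lambda>s. \<bar>jump L s \<omega>\<bar>) ` J) = \<bar>jump L s \<omega>\<bar>" by auto
      then have "\<forall>r\<in>J. \<bar>jump L r \<omega>\<bar> \<le> \<bar>jump L s \<omega>\<bar>"
        using fin by (metis Max_ge finite_imageI imageI)
      then show ?thesis using s that by blast
    qed
    have "\<bar>jump L r \<omega>\<bar> \<le> \<bar>jump L s \<omega>\<bar>" if "r \<in> {a<..b}" for r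
    proof (cases "r \<in> J")
      case False
      then have "\<bar>jump L r \<omega>\<bar> \<le> \<bar>jump L s0 \<omega>\<bar>"
        using that by (auto simp: J_def)
      then show ?thesis using s \<open>s0 \<in> J\<close> by force
    qed (use s in blast)
    then show ?thesis using s by (auto simp: J_def)
  qed
  then have *: "max_jump_time L a b \<omega> \<in> {a<..b} \<and> (\<forall>r\<in>{a<..b}. \<bar>jump L r \<omega>\<bar> \<le> \<bar>jump L (max_jump_time L a b \<omega>) \<omega>\<bar>)"
    unfolding max_jump_time_def by (rule someI_ex)
  show "max_jump_time L a b \<omega> \<in> {a<..b}" using * by blast
  show "\<And>r. r \<in> {a<..b} \<Longrightarrow> \<bar>jump L r \<omega>\<bar> \<le> \<bar>jump L (max_jump_time L a b \<omega>) \<omega>\<bar>"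
    using * by blast
qed

section \<open>Integrals against a random measure\<close>

lemma measurable_nn_integral_family:
  assumes sets: "\<And>\<omega>. \<omega> \<in> space M \<Longrightarrow> sets (\<kappa> \<omega>) = sets N"
    and meas: "\<And>B. B \<in> sets N \<Longrightarrow> (\<lambda>\<omega>. emeasure (\<kappa> \<omega>) B) \<in> borel_measurable M"
    and f: "f \<in> borel_measurable N"
  shows "(\<lambda>\<omega>. \<integral>\<^sup>+x. f x \<partial>\<kappa> \<omega>) \<in> borel_measurable M"
  using f
proof induction
  case (cong f g)
  then have "(\<integral>\<^sup>+x. f x \<partial>\<kappa> \<omega>) = (\<integral>\<^sup>+x. g x \<partial>\<kappa> \<omega>)" if "\<omega> \<in> space M" for \<omega>
    using sets_eq_imp_space_eq[OF sets[OF that]] by (intro nn_integral_cong) auto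
  then show ?case using cong by (simp cong: measurable_cong)
next
  case (set A)
  then show ?case using meas[OF set] sets by (simp cong: measurable_cong)
next
  case (mult u c)
  then have "(\<integral>\<^sup>+x. c * u x \<partial>\<kappa> \<omega>) = c * (\<integral>\<^sup>+x. u x \<partial>\<kappa> \<omega>)" if "\<omega> \<in> space M" for \<omega>
    by (intro nn_integral_cmult) (simp add: measurable_cong_sets[OF sets[OF that] refl])
  then show ?case using mult by (simp cong: measurable_cong)
next
  case (add u w)
  then have "(\<integral>\<^sup>+x. w x + u x \<partial>\<kappa> \<omega>) = (\<integral>\<^sup>+x. w x \<partial>\<kappa> \<omega>) + (\<integral>\<^sup>+x. u x \<partial>\<kappa> \<omega>)" if "\<omega> \<in> space M" for \<omega>
    by (intro nn_integral_add) (simp_all add: measurable_cong_sets[OF sets[OF that] refl])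
  then show ?case using add by (simp cong: measurable_cong)
next
  case (seq U)
  then have "(\<integral>\<^sup>+x. (SUP i. U i) x \<partial>\<kappa> \<omega>) = (SUP i. \<integral>\<^sup>+x. U i x \<partial>\<kappa> \<omega>)" if "\<omega> \<in> space M" for \<omega>
    unfolding SUP_apply
    by (intro nn_integral_monotone_convergence_SUP) (simp_all add: measurable_cong_sets[OF sets[OF that] refl])
  then show ?case using seq by (simp cong: measurable_cong)
qed

text \<open>A comparison of two measures extends from sets to nonnegative functions. It is meant for
  \<open>g\<close> the indicator of a large jump and \<open>D\<close> the region of small jumps:
  independence is available for counts of sets, and this carries it over to the sum of the small
  jumps. Only subsets of \<open>D\<close> are tested because those are disjoint from the region of
  large jumps.\<close>

lemma nn_integral_family_le:
  assumes sets: "\<And>\<omega>. \<omega> \<in> space M \<Longrightarrow> sets (\<kappa> \<omega>) = sets \<Lambda>"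
    and meas: "\<And>B. B \<in> sets \<Lambda> \<Longrightarrow> (\<lambda>\<omega>. emeasure (\<kappa> \<omega>) B) \<in> borel_measurable M"
    and g [measurable]: "g \<in> borel_measurable M" and D [measurable]: "D \<in> sets \<Lambda>"
    and le: "\<And>B. B \<in> sets \<Lambda> \<Longrightarrow> B \<subseteq> D \<Longrightarrow> (\<integral>\<^sup>+\<omega>. g \<omega> * emeasure (\<kappa> \<omega>) B \<partial>M) \<le> c * emeasure \<Lambda> B"
    and f: "f \<in> borel_measurable \<Lambda>"
  shows "(\<integral>\<^sup>+\<omega>. g \<omega> * (\<integral>\<^sup>+x\<in>D. f x \<partial>\<kappa> \<omega>) \<partial>M) \<le> c * (\<integral>\<^sup>+x\<in>D. f x \<partial>\<Lambda>)"
proof -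
  have meas_D: "(\<lambda>\<omega>. \<integral>\<^sup>+x\<in>D. f x \<partial>\<kappa> \<omega>) \<in> borel_measurable M" if [measurable]: "f \<in> borel_measurable \<Lambda>" for f
    using sets meas
  proof (rule measurable_nn_integral_family)
    show "(\<lambda>x. f x * indicator D x) \<in> borel_measurable \<Lambda>" by measurable
  qed
  show ?thesis
    using f
  proof induction
    case (cong f h)
    have "(\<integral>\<^sup>+x\<in>D. f x \<partial>\<kappa> \<omega>) = (\<integral>\<^sup>+x\<in>D. h x \<partial>\<kappa> \<omega>)" if "\<omega> \<in> space M" for \<omega>
      using sets_eq_imp_space_eq[OF sets[OF that]] cong by (intro nn_integral_cong) auto
    moreover have "(\<integral>\<^sup>+x\<in>D. f x \<partial>\<Lambda>) = (\<integral>\<^sup>+x\<in>D. h x \<partial>\<Lambda>)"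
      using cong by (intro nn_integral_cong) auto
    ultimately show ?case using cong by (simp cong: nn_integral_cong)
  next
    case (set A)
    have "(\<integral>\<^sup>+x\<in>D. indicator A x \<partial>\<kappa> \<omega>) = emeasure (\<kappa> \<omega>) (A \<inter> D)" if "\<omega> \<in> space M" for \<omega>
      using set sets[OF that] by (simp flip: indicator_inter_arith)
    then show ?case using le[of "A \<inter> D"] set
      by (simp flip: indicator_inter_arith cong: nn_integral_cong)
  next
    case (mult u a)
    note [measurable] = \<open>u \<in> borel_measurable \<Lambda>\<close>
    note [measurable] = meas_D[OF \<open>u \<in> borel_measurable \<Lambda>\<close>]
    have "(\<integral>\<^sup>+x\<in>D. a * u x \<partial>\<kappa> \<omega>) = a * (\<integral>\<^sup>+x\<in>D. u x \<partial>\<kappa> \<omega>)" if "\<omega> \<in> space M" for \<omega>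
      unfolding mult.assoc
      by (intro nn_integral_cmult) (simp add: measurable_cong_sets[OF sets[OF that] refl])
    then have "(\<integral>\<^sup>+\<omega>. g \<omega> * (\<integral>\<^sup>+x\<in>D. a * u x \<partial>\<kappa> \<omega>) \<partial>M) = (\<integral>\<^sup>+\<omega>. a * (g \<omega> * (\<integral>\<^sup>+x\<in>D. u x \<partial>\<kappa> \<omega>)) \<partial>M)"
      by (intro nn_integral_cong) (simp add: mult_ac)
    also have "\<dots> = a * (\<integral>\<^sup>+\<omega>. g \<omega> * (\<integral>\<^sup>+x\<in>D. u x \<partial>\<kappa> \<omega>) \<partial>M)"
      by (intro nn_integral_cmult) measurable
    also have "\<dots> \<le> a * (c * (\<integral>\<^sup>+x\<in>D. u x \<partial>\<Lambda>))"
      by (intro mult_left_mono mult.IH) auto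
    also have "\<dots> = c * (\<integral>\<^sup>+x\<in>D. a * u x \<partial>\<Lambda>)"
      by (simp add: mult.assoc nn_integral_cmult mult.left_commute[of c a])
    finally show ?case .
  next
    case (add u w)
    note [measurable] = \<open>u \<in> borel_measurable \<Lambda>\<close> \<open>w \<in> borel_measurable \<Lambda>\<close>
    have m: "(\<lambda>x. u x * indicator D x) \<in> borel_measurable \<Lambda>" "(\<lambda>x. w x * indicator D x) \<in> borel_measurable \<Lambda>"
      by measurable
    note [measurable] = meas_D[OF \<open>u \<in> borel_measurable \<Lambda>\<close>] meas_D[OF \<open>w \<in> borel_measurable \<Lambda>\<close>]
    have "(\<integral>\<^sup>+x\<in>D. (w x + u x) \<partial>\<kappa> \<omega>) = (\<integral>\<^sup>+x\<in>D. w x \<partial>\<kappa> \<omega>) + (\<integral>\<^sup>+x\<in>D. u x \<partial>\<kappa> \<omega>)" if "\<omega> \<in> space M" for \<omega>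
      unfolding distrib_right using m
      by (intro nn_integral_add) (simp_all add: measurable_cong_sets[OF sets[OF that] refl])
    then have "(\<integral>\<^sup>+\<omega>. g \<omega> * (\<integral>\<^sup>+x\<in>D. (w x + u x) \<partial>\<kappa> \<omega>) \<partial>M) =
        (\<integral>\<^sup>+\<omega>. g \<omega> * (\<integral>\<^sup>+x\<in>D. w x \<partial>\<kappa> \<omega>) + g \<omega> * (\<integral>\<^sup>+x\<in>D. u x \<partial>\<kappa> \<omega>) \<partial>M)"
      by (intro nn_integral_cong) (simp add: distrib_left)
    also have "\<dots> = (\<integral>\<^sup>+\<omega>. g \<omega> * (\<integral>\<^sup>+x\<in>D. w x \<partial>\<kappa> \<omega>) \<partial>M) + (\<integral>\<^sup>+\<omega>. g \<omega> * (\<integral>\<^sup>+x\<in>D. u x \<partial>\<kappa> \<omega>) \<partial>M)"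
      by (intro nn_integral_add) measurable
    also have "\<dots> \<le> c * (\<integral>\<^sup>+x\<in>D. w x \<partial>\<Lambda>) + c * (\<integral>\<^sup>+x\<in>D. u x \<partial>\<Lambda>)"
      by (intro add_mono add.IH)
    also have "\<dots> = c * (\<integral>\<^sup>+x\<in>D. (w x + u x) \<partial>\<Lambda>)"
      unfolding distrib_right using m by (simp add: nn_integral_add distrib_left)
    finally show ?case .
  next
    case (seq U)
    note [measurable] = seq(1)
    have m: "(\<lambda>x. U i x * indicator D x) \<in> borel_measurable \<Lambda>" for i
      by measurable
    note [measurable] = meas_D[OF seq(1)]
    have inc: "incseq (\<lambda>i x. U i x * indicator D x)"
      using \<open>incseq U\<close> by (auto simp: incseq_def le_fun_def intro!: mult_right_mono)
    have sup: "(SUP i. U i) x * indicator D x = (SUP i. U i x * indicator D x)" for x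
      unfolding SUP_apply by (simp add: SUP_mult_right_ennreal)
    have "(\<integral>\<^sup>+x\<in>D. (SUP i. U i) x \<partial>\<kappa> \<omega>) = (SUP i. \<integral>\<^sup>+x\<in>D. U i x \<partial>\<kappa> \<omega>)" if "\<omega> \<in> space M" for \<omega>
      unfolding sup using inc m
      by (intro nn_integral_monotone_convergence_SUP) (simp_all add: measurable_cong_sets[OF sets[OF that] refl])
    then have "(\<integral>\<^sup>+\<omega>. g \<omega> * (\<integral>\<^sup>+x\<in>D. (SUP i. U i) x \<partial>\<kappa> \<omega>) \<partial>M) =
        (\<integral>\<^sup>+\<omega>. (SUP i. g \<omega> * (\<integral>\<^sup>+x\<in>D. U i x \<partial>\<kappa> \<omega>)) \<partial>M)"
      by (intro nn_integral_cong) (simp add: SUP_mult_left_ennreal)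
    also have "\<dots> = (SUP i. \<integral>\<^sup>+\<omega>. g \<omega> * (\<integral>\<^sup>+x\<in>D. U i x \<partial>\<kappa> \<omega>) \<partial>M)"
    proof (intro nn_integral_monotone_convergence_SUP)
      show "incseq (\<lambda>i \<omega>. g \<omega> * (\<integral>\<^sup>+x\<in>D. U i x \<partial>\<kappa> \<omega>))"
        using inc by (auto simp: incseq_def le_fun_def intro!: mult_left_mono nn_integral_mono)
    qed measurable
    also have "\<dots> \<le> (SUP i. c * (\<integral>\<^sup>+x\<in>D. U i x \<partial>\<Lambda>))"
      by (intro SUP_mono) (use seq.IH in blast)
    also have "\<dots> = c * (\<integral>\<^sup>+x\<in>D. (SUP i. U i) x \<partial>\<Lambda>)"
      unfolding sup using inc m
      by (subst nn_integral_monotone_convergence_SUP) (auto simp: SUP_mult_left_ennreal)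
    finally show ?case .
  qed
qed

section \<open>Poisson distributed counts\<close>

context prob_space
begin

text \<open>A count takes values in \<open>ennreal\<close>, so for the mean it must first be seen to
  be a natural number almost surely: the Poisson weights add up to 1. Both probability bounds rest
  on \<open>1 - r \<le> exp (- r)\<close>.\<close>

lemma
  assumes X [measurable]: "X \<in> borel_measurable M" and "0 \<le> r"
    and P: "\<And>k::nat. prob {\<omega>\<in>space M. X \<omega> = of_nat k} = r ^ k / fact k * exp (- r)"
  shows poisson_mean: "(\<integral>\<^sup>+\<omega>. X \<omega> \<partial>M) = ennreal r"
    and poisson_prob_pos: "prob {\<omega>\<in>space M. X \<omega> \<noteq> 0} \<le> r"
    and poisson_prob_ge_2: "prob {\<omega>\<in>space M. X \<omega> \<noteq> 0 \<and> X \<omega> \<noteq> 1} \<le> r\<^sup>2"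
proof -
  define E where "E k = {\<omega>\<in>space M. X \<omega> = of_nat k}" for k :: nat
  have E [measurable]: "E k \<in> sets M" for k unfolding E_def by measurable
  have disj: "disjoint_family E"
    by (auto simp: disjoint_family_on_def E_def)
  have exp: "(\<lambda>k. r ^ k / fact k) sums exp r"
    using exp_converges[of r] by (simp add: divide_inverse mult.commute)
  then have "(\<lambda>k. r ^ k / fact k * exp (- r)) sums (exp r * exp (- r))"
    by (rule sums_mult2)
  moreover have "(\<lambda>k. prob (E k)) sums prob (\<Union>k. E k)"
    using disj E by (intro finite_measure_UNION) auto
  ultimately have "prob (\<Union>k. E k) = 1"
    by (simp add: E_def P sums_unique2 flip: exp_add)
  then have AE_E: "AE \<omega> in M. \<omega> \<in> (\<Union>k. E k)"
    by (rule prob_eq_1[THEN iffD1, rotated]) auto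
  have "(\<integral>\<^sup>+\<omega>. X \<omega> \<partial>M) = (\<integral>\<^sup>+\<omega>. (\<Sum>k. of_nat k * indicator (E k) \<omega>) \<partial>M)"
  proof (rule nn_integral_cong_AE, use AE_E in eventually_elim)
    fix \<omega> assume "\<omega> \<in> (\<Union>k. E k)"
    then obtain j where j: "\<omega> \<in> E j" by auto
    have "(\<Sum>k. of_nat k * indicator (E k) \<omega> :: ennreal) = (\<Sum>k\<in>{j}. of_nat k * indicator (E k) \<omega>)"
      using j disj by (intro suminf_finite) (auto simp: disjoint_family_on_def indicator_def)
    then show "X \<omega> = (\<Sum>k. of_nat k * indicator (E k) \<omega>)"
      unfolding \<open>_ = (\<Sum>k\<in>{j}. _ k)\<close> using j by (simp add: E_def)
  qed
  also have "\<dots> = (\<Sum>k. ennreal (real k * (r ^ k / fact k * exp (- r))))"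
    by (subst nn_integral_suminf)
       (auto simp: nn_integral_cmult_indicator emeasure_eq_measure P[folded E_def] ennreal_of_nat_eq_real_of_nat \<open>0 \<le> r\<close> simp flip: ennreal_mult' intro!: suminf_cong)
  also have "\<dots> = ennreal r"
  proof (rule suminf_ennreal_eq)
    show "0 \<le> real k * (r ^ k / fact k * exp (- r))" for k
      using \<open>0 \<le> r\<close> by simp
    have "(\<lambda>k. r * (r ^ k / fact k) * exp (- r)) sums (r * exp r * exp (- r))"
      by (intro sums_mult sums_mult2 exp)
    \<comment> \<open>Cancelling \<open>Suc k\<close> against the factorial shows the series of the
      mean without its term for 0, which vanishes.\<close>
    also have "(\<lambda>k. r * (r ^ k / fact k) * exp (- r)) =
        (\<lambda>k. real (Suc k) * (r ^ Suc k / fact (Suc k) * exp (- r)))"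
      by (simp add: fun_eq_iff mult.assoc del: of_nat_Suc)
    finally have "(\<lambda>k. real k * (r ^ k / fact k * exp (- r))) sums
        (r * exp r * exp (- r) + real 0 * (r ^ 0 / fact 0 * exp (- r)))"
      by (rule sums_Suc)
    then show "(\<lambda>k. real k * (r ^ k / fact k * exp (- r))) sums r"
      by (simp add: mult.assoc flip: exp_add)
  qed
  finally show "(\<integral>\<^sup>+\<omega>. X \<omega> \<partial>M) = ennreal r" .
  have exp_ge: "1 - r \<le> exp (- r)"
    using exp_ge_add_one_self[of "- r"] by simp
  have "{\<omega>\<in>space M. X \<omega> \<noteq> 0} = space M - E 0" by (auto simp: E_def)
  then have "prob {\<omega>\<in>space M. X \<omega> \<noteq> 0} = 1 - exp (- r)"
    using prob_compl[OF E, of 0] P[of 0] by (simp add: E_def)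
  with exp_ge show "prob {\<omega>\<in>space M. X \<omega> \<noteq> 0} \<le> r" by simp
  have "{\<omega>\<in>space M. X \<omega> \<noteq> 0 \<and> X \<omega> \<noteq> 1} = space M - (E 0 \<union> E 1)" by (auto simp: E_def)
  then have "prob {\<omega>\<in>space M. X \<omega> \<noteq> 0 \<and> X \<omega> \<noteq> 1} = 1 - prob (E 0 \<union> E 1)"
    using prob_compl[of "E 0 \<union> E 1"] by simp
  also have "prob (E 0 \<union> E 1) = prob (E 0) + prob (E 1)"
    using disj by (intro finite_measure_Union) (auto simp: disjoint_family_on_def)
  also have "\<dots> = (1 + r) * exp (- r)"
    using P[of 0] P[of 1] by (simp add: E_def algebra_simps)
  finally have "prob {\<omega>\<in>space M. X \<omega> \<noteq> 0 \<and> X \<omega> \<noteq> 1} = 1 - (1 + r) * exp (- r)" .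
  \<comment> \<open>The left side is \<open>1 - r\<^sup>2\<close>, which is where the square in the
    bound comes from.\<close>
  moreover have "(1 + r) * (1 - r) \<le> (1 + r) * exp (- r)"
    using \<open>0 \<le> r\<close> exp_ge by (intro mult_left_mono) auto
  ultimately show "prob {\<omega>\<in>space M. X \<omega> \<noteq> 0 \<and> X \<omega> \<noteq> 1} \<le> r\<^sup>2"
    by (simp add: algebra_simps power2_eq_square)
qed

end

section \<open>Pure jump Levy processes with summable jumps\<close>

text \<open>By Markov's inequality \<open>f\<close> is at least \<open>1 / Suc n\<close> only on a
  set of finite measure, and these sets cover everything but the zeros of \<open>f\<close>. With
  \<open>f z = \<bar>z\<bar>\<close> this makes \<open>\<nu>\<close> sigma-finite, as needed for
  Fubini with \<open>jump_intensity\<close>.\<close>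

lemma sigma_finite_measureI_nn_integral_pos:
  assumes [measurable]: "f \<in> borel_measurable M" and fin: "(\<integral>\<^sup>+x. f x \<partial>M) < \<infinity>"
    and zero: "emeasure M {x\<in>space M. f x = 0} < \<infinity>"
  shows "sigma_finite_measure M"
proof
  define A where "A n = {x\<in>space M. ennreal (1 / real (Suc n)) \<le> f x}" for n
  have [measurable]: "A n \<in> sets M" for n unfolding A_def by measurable
  have "emeasure M (A n) \<noteq> \<infinity>" for n
  proof -
    have "ennreal (1 / real (Suc n)) * emeasure M (A n) \<le> (\<integral>\<^sup>+x. f x \<partial>M)"
      by (subst nn_integral_cmult_indicator[symmetric])
         (auto simp: A_def split: split_indicator intro!: nn_integral_mono)
    also note fin
    finally show ?thesis
      by (auto simp: ennreal_mult_less_top less_top simp del: of_nat_Suc)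
  qed
  moreover have "space M \<subseteq> (\<Union>n. A n) \<union> {x\<in>space M. f x = 0}"
  proof
    fix x assume x: "x \<in> space M"
    show "x \<in> (\<Union>n. A n) \<union> {x\<in>space M. f x = 0}"
    proof (cases "f x")
      case (real r)
      show ?thesis
      proof (cases "r = 0")
        case False
        then have "0 < r" using real by simp
        then obtain n where "1 / real (Suc n) < r"
          using reals_Archimedean by (auto simp: inverse_eq_divide)
        then have "x \<in> A n" using real x by (auto simp: A_def intro!: ennreal_leI)
        then show ?thesis by blast
      qed (use real x in auto)
    next
      case top
      then show ?thesis using x by (auto simp: A_def)
    qed
  qed
  ultimately show "\<exists>F. countable F \<and> F \<subseteq> sets M \<and> \<Union>F = space M \<and> (\<forall>a\<in>F. emeasure M a \<noteq> \<infinity>)"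
    using zero by (intro exI[of _ "insert {x\<in>space M. f x = 0} (range A)"]) (auto simp: A_def)
qed

locale summable_levy = prob_space M for M :: "'w measure" +
  fixes \<nu> :: "real measure" and L :: "real \<Rightarrow> 'w \<Rightarrow> real"
  assumes levy: "pure_jump_levy M \<nu> L"
    and nu_abs: "(\<integral>\<^sup>+z. ennreal \<bar>z\<bar> \<partial>\<nu>) < \<infinity>"
begin

abbreviation "\<mu> \<equiv> jump_measure L"
abbreviation "\<Lambda> \<equiv> jump_intensity \<nu>"

lemma sets_nu [measurable_cong]: "sets \<nu> = sets borel"
  using levy by (simp add: pure_jump_levy_def levy_measure_def)

lemma space_nu [simp]: "space \<nu> = UNIV"
  using sets_eq_imp_space_eq[OF sets_nu] by simp

lemma cadlag_path: "\<omega> \<in> space M \<Longrightarrow> cadlag (\<lambda>s. L s \<omega>)"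
  using levy by (simp add: pure_jump_levy_def levy_process_def)

lemma poisson: "poisson_random_measure M \<mu> \<Lambda>"
  using levy by (simp add: pure_jump_levy_def)

lemma sets_intensity: "sets \<Lambda> = sets (borel \<Otimes>\<^sub>M borel)"
  unfolding jump_intensity_def by (intro sets_pair_measure_cong) (simp_all add: sets_nu)

lemma sets_jump_measure: "sets (\<mu> \<omega>) = sets (borel \<Otimes>\<^sub>M borel)"
  by (simp add: jump_measure_def)

lemma measurable_emeasure_jump_measure [measurable]:
  "B \<in> sets (borel \<Otimes>\<^sub>M borel) \<Longrightarrow> (\<lambda>\<omega>. emeasure (\<mu> \<omega>) B) \<in> borel_measurable M"
  using poisson unfolding poisson_random_measure_def sets_intensity by blast

lemma measurable_nn_integral_jump_measure [measurable]:
  "f \<in> borel_measurable (borel \<Otimes>\<^sub>M borel) \<Longrightarrow> (\<lambda>\<omega>. \<integral>\<^sup>+p. f p \<partial>\<mu> \<omega>) \<in> borel_measurable M"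
  by (rule measurable_nn_integral_family[where N="borel \<Otimes>\<^sub>M borel"]) (auto simp: sets_jump_measure)

sublocale nu: sigma_finite_measure \<nu>
proof (rule sigma_finite_measureI_nn_integral_pos)
  have "{z. ennreal \<bar>z\<bar> = 0} = {0}" by auto
  then show "emeasure \<nu> {x\<in>space \<nu>. ennreal \<bar>x\<bar> = 0} < \<infinity>"
    using levy by (simp add: pure_jump_levy_def levy_measure_def)
qed (use nu_abs in auto)

lemma emeasure_intensity_Times:
  assumes "T \<in> sets borel" "T \<subseteq> {0..}" "B \<in> sets borel"
  shows "emeasure \<Lambda> (T \<times> B) = emeasure lborel T * emeasure \<nu> B"
proof -
  have "emeasure (density lborel (indicator {0..})) T = emeasure lborel ({0..} \<inter> T)"
    using assms by (subst emeasure_density) (auto simp flip: indicator_inter_arith)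
  then show ?thesis
    unfolding jump_intensity_def using assms
    by (subst nu.emeasure_pair_measure_Times) (auto simp: sets_nu Int_absorb1)
qed

lemma poisson_prob:
  assumes "B \<in> sets (borel \<Otimes>\<^sub>M borel)" "emeasure \<Lambda> B < \<infinity>"
  shows "prob {\<omega>\<in>space M. emeasure (\<mu> \<omega>) B = of_nat k} =
    measure \<Lambda> B ^ k / fact k * exp (- measure \<Lambda> B)"
  using poisson assms unfolding poisson_random_measure_def sets_intensity by blast

text \<open>A Poisson count has its intensity as mean if that is finite; for infinite intensity the
  upper bound is trivial.\<close>

lemma nn_integral_jump_count_le:
  assumes "B \<in> sets (borel \<Otimes>\<^sub>M borel)"
  shows "(\<integral>\<^sup>+\<omega>. emeasure (\<mu> \<omega>) B \<partial>M) \<le> emeasure \<Lambda> B"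
proof (cases "emeasure \<Lambda> B < \<infinity>")
  case True
  then have "(\<integral>\<^sup>+\<omega>. emeasure (\<mu> \<omega>) B \<partial>M) = ennreal (measure \<Lambda> B)"
    using assms poisson_prob by (intro poisson_mean) auto
  then show ?thesis using True by (simp add: emeasure_eq_ennreal_measure)
qed (simp add: not_less top_unique)

lemma indep_jump_counts:
  assumes "B \<in> sets (borel \<Otimes>\<^sub>M borel)" "C \<in> sets (borel \<Otimes>\<^sub>M borel)" "B \<inter> C = {}"
    and [measurable]: "f \<in> borel_measurable borel"
  shows "(\<integral>\<^sup>+\<omega>. f (emeasure (\<mu> \<omega>) B) * emeasure (\<mu> \<omega>) C \<partial>M) =
    (\<integral>\<^sup>+\<omega>. f (emeasure (\<mu> \<omega>) B) \<partial>M) * (\<integral>\<^sup>+\<omega>. emeasure (\<mu> \<omega>) C \<partial>M)"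
proof -
  \<comment> \<open>The definition of a Poisson random measure speaks of families indexed by natural
    numbers: \<open>B\<close> and \<open>C\<close> become the members 0 and 1, and \<open>f\<close>
    is applied to the first count only.\<close>
  define D where "D i = (if i = 0 then B else C)" for i :: nat
  define F where "F i = (if i = 0 then f else (\<lambda>x. x))" for i :: nat
  have "finite {0, 1::nat}" "D ` {0, 1} \<subseteq> sets \<Lambda>" "disjoint_family_on D {0, 1}"
    using assms by (auto simp: D_def sets_intensity disjoint_family_on_def)
  then have "indep_vars (\<lambda>_. borel) (\<lambda>i \<omega>. emeasure (\<mu> \<omega>) (D i)) {0, 1}"
    using poisson unfolding poisson_random_measure_def by blast
  then have "indep_vars (\<lambda>_. borel) (\<lambda>i \<omega>. F i (emeasure (\<mu> \<omega>) (D i))) {0, 1}"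
    by (rule indep_vars_compose2) (auto simp: F_def)
  from indep_vars_nn_integral[OF _ this] show ?thesis
    by (simp add: F_def D_def)
qed

text \<open>\<open>0 \<notin> B\<close> keeps out the times without a jump, which the right-hand
  side would otherwise count.\<close>

lemma emeasure_jump_measure_Times:
  assumes "0 \<le> a" "B \<in> sets borel" "0 \<notin> B"
  shows "emeasure (\<mu> \<omega>) ({a<..b} \<times> B) = emeasure (count_space UNIV) {s\<in>{a<..b}. jump L s \<omega> \<in> B}"
proof -
  have "{s. 0 < s \<and> jump L s \<omega> \<noteq> 0 \<and> (s, jump L s \<omega>) \<in> {a<..b} \<times> B} = {s\<in>{a<..b}. jump L s \<omega> \<in> B}"
    using assms by auto
  then show ?thesis
    using assms by (subst emeasure_jump_measure) auto
qed

text \<open>Replaces a condition on uncountably many times by one on a single count, which is a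
  random variable.\<close>

lemma no_large_jump_eq:
  assumes "0 \<le> a" "0 \<le> u"
  shows "no_large_jump M L a b u =
    {\<omega>\<in>space M. emeasure (\<mu> \<omega>) ({a<..b} \<times> {z. u < \<bar>z\<bar>}) = 0}"
  using assms unfolding no_large_jump_def
  by (subst emeasure_jump_measure_Times) (auto simp: emeasure_count_space_eq_0 not_less)

lemma sets_no_large_jump [measurable]:
  assumes "0 \<le> a" "0 \<le> u"
  shows "no_large_jump M L a b u \<in> sets M"
  unfolding no_large_jump_eq[OF assms] by measurable

text \<open>No measurability of \<open>max_jump_time\<close> is established; only the size of the
  jump at that time enters, and this is the supremum \<open>Mx\<close>.\<close>

lemma sets_small_other_jumps [measurable]:
  assumes "0 \<le> a"
  shows "small_other_jumps M L a b c \<in> sets M"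
proof (cases "a < b")
  case True
  define Mx where "Mx \<omega> = (SUP s\<in>{a<..b}. ennreal \<bar>jump L s \<omega>\<bar>)" for \<omega>
  define S where "S \<omega> = (\<Sum>\<^sub>\<infinity>s\<in>{a<..b}. ennreal \<bar>jump L s \<omega>\<bar>)" for \<omega>
  have "S \<omega> = (\<integral>\<^sup>+p. indicator {a<..b} (fst p) * ennreal \<bar>snd p\<bar> \<partial>\<mu> \<omega>)" for \<omega>
    unfolding S_def using \<open>0 \<le> a\<close> by (subst nn_integral_jump_measure) auto
  then have [measurable]: "S \<in> borel_measurable M"
    by (simp cong: measurable_cong)
  have [measurable]: "Mx \<in> borel_measurable M"
  proof (rule borel_measurableI_le)
    fix y :: ennreal
    show "{\<omega>\<in>space M. Mx \<omega> \<le> y} \<in> sets M"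
    proof (cases y)
      case (real r)
      \<comment> \<open>The supremum over uncountably many times is at most \<open>r\<close> exactly
        if no jump exceeds \<open>r\<close>, an event already known to be measurable.\<close>
      then have "{\<omega>\<in>space M. Mx \<omega> \<le> y} = no_large_jump M L a b r"
        by (auto simp: Mx_def SUP_le_iff no_large_jump_def)
      then show ?thesis using sets_no_large_jump \<open>0 \<le> a\<close> real by simp
    qed simp
  qed
  \<comment> \<open>Written with a sum instead of a difference because \<open>S \<omega>\<close> may
    be infinite; \<open>Mx \<omega>\<close> is the size of one jump, hence finite, and
    cancels.\<close>
  have "(\<Sum>\<^sub>\<infinity>s\<in>{a<..b} - {max_jump_time L a b \<omega>}. ennreal \<bar>jump L s \<omega>\<bar>) \<le> ennreal c \<longleftrightarrow>
      S \<omega> \<le> Mx \<omega> + ennreal c" if "\<omega> \<in> space M" for \<omega>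
  proof -
    define \<tau> where "\<tau> = max_jump_time L a b \<omega>"
    have \<tau>: "\<tau> \<in> {a<..b}" "\<And>r. r \<in> {a<..b} \<Longrightarrow> \<bar>jump L r \<omega>\<bar> \<le> \<bar>jump L \<tau> \<omega>\<bar>"
      unfolding \<tau>_def by (rule cadlag_max_jump[where L=L and \<omega>=\<omega>, OF cadlag_path[OF that] \<open>0 \<le> a\<close> True]; assumption)+
    then have "Mx \<omega> = ennreal \<bar>jump L \<tau> \<omega>\<bar>"
      unfolding Mx_def by (intro antisym SUP_least SUP_upper) (auto intro: ennreal_leI)
    moreover have "S \<omega> = ennreal \<bar>jump L \<tau> \<omega>\<bar> + (\<Sum>\<^sub>\<infinity>s\<in>{a<..b} - {\<tau>}. ennreal \<bar>jump L s \<omega>\<bar>)"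
      unfolding S_def using \<tau>(1)
      by (subst infsum_insert[symmetric]) (auto intro: nonneg_summable_on_complete simp: insert_absorb)
    ultimately show ?thesis
      unfolding \<tau>_def[symmetric] by simp
  qed
  then have "small_other_jumps M L a b c = {\<omega>\<in>space M. S \<omega> \<le> Mx \<omega> + ennreal c}"
    unfolding small_other_jumps_def by blast
  then show ?thesis by simp
qed (simp add: small_other_jumps_def)

lemma nn_integral_intensity_le:
  assumes "0 \<le> a" "a \<le> b" "B \<in> sets borel"
  shows "(\<integral>\<^sup>+p\<in>{a<..b} \<times> B. ennreal \<bar>snd p\<bar> \<partial>\<Lambda>) \<le> ennreal (b - a) * (\<integral>\<^sup>+z. ennreal \<bar>z\<bar> \<partial>\<nu>)"
proof -
  have [measurable]: "B \<in> sets borel" by fact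
  \<comment> \<open>Dropping \<open>B\<close> leaves the full first moment, so the constant does not
    depend on the truncation level.\<close>
  have "(\<integral>\<^sup>+p\<in>{a<..b} \<times> B. ennreal \<bar>snd p\<bar> \<partial>\<Lambda>) \<le> (\<integral>\<^sup>+p. indicator {a<..b} (fst p) * ennreal \<bar>snd p\<bar> \<partial>\<Lambda>)"
    by (intro nn_integral_mono) (auto split: split_indicator)
  also have "\<dots> = (\<integral>\<^sup>+s. \<integral>\<^sup>+z. indicator {a<..b} s * ennreal \<bar>z\<bar> \<partial>\<nu> \<partial>density lborel (indicator {0..}))"
    unfolding jump_intensity_def by (subst nu.nn_integral_fst[symmetric]) auto
  also have "\<dots> = (\<integral>\<^sup>+s. indicator {0..} s * (indicator {a<..b} s * (\<integral>\<^sup>+z. ennreal \<bar>z\<bar> \<partial>\<nu>)) \<partial>lborel)"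
    by (subst nn_integral_density) (auto simp: nn_integral_cmult)
  also have "\<dots> = (\<integral>\<^sup>+s. (\<integral>\<^sup>+z. ennreal \<bar>z\<bar> \<partial>\<nu>) * indicator {a<..b} s \<partial>lborel)"
    using \<open>0 \<le> a\<close> by (intro nn_integral_cong) (auto split: split_indicator)
  also have "\<dots> = ennreal (b - a) * (\<integral>\<^sup>+z. ennreal \<bar>z\<bar> \<partial>\<nu>)"
    using \<open>a \<le> b\<close> by (subst nn_integral_cmult_indicator) (auto simp: mult.commute)
  finally show ?thesis .
qed

text \<open>Markov's inequality; it serves to trade one of the two tail masses in the bound for two
  large jumps against a factor \<open>1 / u\<close>.\<close>

lemma emeasure_large_jumps_le:
  assumes "0 < u"
  shows "emeasure \<nu> {z. u < \<bar>z\<bar>} \<le> ennreal (1 / u) * (\<integral>\<^sup>+z. ennreal \<bar>z\<bar> \<partial>\<nu>)"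
proof -
  have "emeasure \<nu> {z. u < \<bar>z\<bar>} = (\<integral>\<^sup>+z. indicator {z. u < \<bar>z\<bar>} z \<partial>\<nu>)"
    by (subst nn_integral_indicator) (auto simp: sets_nu)
  also have "\<dots> \<le> (\<integral>\<^sup>+z. ennreal (1 / u) * ennreal \<bar>z\<bar> \<partial>\<nu>)"
    using assms by (intro nn_integral_mono)
      (auto simp: indicator_def ennreal_le_iff field_simps simp flip: ennreal_mult' ennreal_1)
  also have "\<dots> = ennreal (1 / u) * (\<integral>\<^sup>+z. ennreal \<bar>z\<bar> \<partial>\<nu>)"
    by (rule nn_integral_cmult) auto
  finally show ?thesis .
qed

text \<open>The first event, a count that is neither 0 nor 1, also absorbs infinite counts. If the
  count is 1, maximality identifies \<open>max_jump_time\<close> with the only time of a large jump,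
  so the other jumps are exactly those of size at most \<open>u\<close>, and their sum is the
  integral in the second event.\<close>

lemma large_and_other_jumps_subset:
  assumes "0 \<le> a" "a < b" "0 \<le> u"
  shows "(space M - no_large_jump M L a b u) \<inter> (space M - small_other_jumps M L a b c) \<subseteq>
    {\<omega>\<in>space M. emeasure (\<mu> \<omega>) ({a<..b} \<times> {z. u < \<bar>z\<bar>}) \<noteq> 0 \<and>
      emeasure (\<mu> \<omega>) ({a<..b} \<times> {z. u < \<bar>z\<bar>}) \<noteq> 1} \<union>
    {\<omega>\<in>space M. emeasure (\<mu> \<omega>) ({a<..b} \<times> {z. u < \<bar>z\<bar>}) \<noteq> 0 \<and>
      ennreal c < (\<integral>\<^sup>+p\<in>{a<..b} \<times> {z. \<bar>z\<bar> \<le> u}. ennreal \<bar>snd p\<bar> \<partial>\<mu> \<omega>)}"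
    (is "?E \<subseteq> ?E1 \<union> ?E2")
proof
  fix \<omega> assume \<omega>: "\<omega> \<in> ?E"
  then have sp: "\<omega> \<in> space M" by auto
  define J where "J = {s\<in>{a<..b}. u < \<bar>jump L s \<omega>\<bar>}"
  define \<tau> where "\<tau> = max_jump_time L a b \<omega>"
  define K where "K = emeasure (\<mu> \<omega>) ({a<..b} \<times> {z. u < \<bar>z\<bar>})"
  have K: "K = emeasure (count_space UNIV) J"
    unfolding K_def J_def using assms by (subst emeasure_jump_measure_Times) auto
  have "K \<noteq> 0" using \<omega> assms by (auto simp: no_large_jump_eq K_def)
  show "\<omega> \<in> ?E1 \<union> ?E2"
  proof (cases "K = 1")
    case True
    then have "card J = 1"
      by (auto simp: K emeasure_count_space split: if_splits)
    then obtain s0 where J: "J = {s0}" by (auto simp: card_1_singleton_iff)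
    have \<tau>: "\<tau> \<in> {a<..b}" "\<And>r. r \<in> {a<..b} \<Longrightarrow> \<bar>jump L r \<omega>\<bar> \<le> \<bar>jump L \<tau> \<omega>\<bar>"
      unfolding \<tau>_def by (rule cadlag_max_jump[where L=L and \<omega>=\<omega>, OF cadlag_path[OF sp] assms(1,2)]; assumption)+
    have "s0 \<in> {a<..b}" "u < \<bar>jump L s0 \<omega>\<bar>" using J by (auto simp: J_def)
    with \<tau> have "\<tau> \<in> J" by (force simp: J_def)
    with J have "J = {\<tau>}" by simp
    \<comment> \<open>\<open>g\<close> vanishes on the jump at \<open>\<tau>\<close> and keeps the
      size of all others, so the sum without \<open>\<tau>\<close> becomes a sum over the whole
      interval.\<close>
    define g where "g z = ennreal \<bar>z\<bar> * indicator {z. \<bar>z\<bar> \<le> u} z" for z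
    have [measurable]: "g \<in> borel_measurable borel" unfolding g_def by measurable
    have "ennreal c < (\<Sum>\<^sub>\<infinity>s\<in>{a<..b} - {\<tau>}. ennreal \<bar>jump L s \<omega>\<bar>)"
      using \<omega> sp by (auto simp: small_other_jumps_def \<tau>_def not_le)
    also have "\<dots> = (\<Sum>\<^sub>\<infinity>s\<in>{a<..b}. g (jump L s \<omega>))"
    proof (rule infsum_cong_neutral)
      fix s assume "s \<in> {a<..b} - ({a<..b} - {\<tau>})"
      then have "s \<in> J" using \<open>J = {\<tau>}\<close> by auto
      then show "g (jump L s \<omega>) = 0" by (simp add: J_def g_def)
    next
      fix s assume "s \<in> ({a<..b} - {\<tau>}) \<inter> {a<..b}"
      then have "s \<notin> J" "s \<in> {a<..b}" using \<open>J = {\<tau>}\<close> by auto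
      then show "ennreal \<bar>jump L s \<omega>\<bar> = g (jump L s \<omega>)" by (auto simp: J_def g_def)
    qed auto
    also have "\<dots> = (\<integral>\<^sup>+p. indicator {a<..b} (fst p) * g (snd p) \<partial>\<mu> \<omega>)"
      using \<open>0 \<le> a\<close> by (subst nn_integral_jump_measure) (auto simp: g_def)
    also have "\<dots> = (\<integral>\<^sup>+p\<in>{a<..b} \<times> {z. \<bar>z\<bar> \<le> u}. ennreal \<bar>snd p\<bar> \<partial>\<mu> \<omega>)"
      by (intro nn_integral_cong) (auto simp: g_def split: split_indicator)
    finally show ?thesis using sp \<open>K \<noteq> 0\<close> unfolding K_def by blast
  qed (use sp \<open>K \<noteq> 0\<close> in \<open>auto simp: K_def\<close>)
qed

text \<open>Each of the two events contributes two factors \<open>b - a\<close>, one first moment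
  and one tail mass of \<open>\<nu>\<close>. The term \<open>1 / u\<close> belongs to two or more
  large jumps, the term \<open>1 / c\<close> to a large jump together with a large sum of small
  ones.\<close>

lemma large_and_other_jumps_le:
  assumes a: "0 \<le> a" "a < b" and u: "0 < u" and c: "0 < c"
  shows "emeasure M ((space M - no_large_jump M L a b u) \<inter> (space M - small_other_jumps M L a b c)) \<le>
    ennreal ((b - a)\<^sup>2 * (1 / u + 1 / c)) * (\<integral>\<^sup>+z. ennreal \<bar>z\<bar> \<partial>\<nu>) * emeasure \<nu> {z. u < \<bar>z\<bar>}"
proof -
  define m where "m = (\<integral>\<^sup>+z. ennreal \<bar>z\<bar> \<partial>\<nu>)"
  define n where "n = emeasure \<nu> {z. u < \<bar>z\<bar>}"
  define B where "B = {a<..b} \<times> {z. u < \<bar>z\<bar>}"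
  define D where "D = {a<..b} \<times> {z. \<bar>z\<bar> \<le> u}"
  have [measurable]: "B \<in> sets (borel \<Otimes>\<^sub>M borel)" "D \<in> sets (borel \<Otimes>\<^sub>M borel)"
    unfolding B_def D_def by measurable
  define K where "K \<omega> = emeasure (\<mu> \<omega>) B" for \<omega>
  define Z where "Z \<omega> = (\<integral>\<^sup>+p\<in>D. ennreal \<bar>snd p\<bar> \<partial>\<mu> \<omega>)" for \<omega>
  have [measurable]: "K \<in> borel_measurable M" unfolding K_def by measurable
  have [measurable]: "Z \<in> borel_measurable M" unfolding Z_def by measurable
  define l where "l = measure \<Lambda> B"
  have n_le: "n \<le> ennreal (1 / u) * m"
    unfolding n_def m_def by (rule emeasure_large_jumps_le) fact
  have "n < \<infinity>" using n_le nu_abs by (auto simp: m_def ennreal_mult_less_top intro: le_less_trans)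
  have LB: "emeasure \<Lambda> B = ennreal (b - a) * n"
    unfolding B_def n_def using a by (subst emeasure_intensity_Times) auto
  then have fin: "emeasure \<Lambda> B < \<infinity>"
    using \<open>n < \<infinity>\<close> by (simp add: ennreal_mult_less_top)
  then have l: "ennreal l = ennreal (b - a) * n" "0 \<le> l"
    using emeasure_eq_ennreal_measure[of \<Lambda> B] by (simp_all add: l_def LB[symmetric])
  note P = poisson_prob[OF \<open>B \<in> sets (borel \<Otimes>\<^sub>M borel)\<close> fin, folded K_def l_def]
  have sq: "ennreal ((b - a)\<^sup>2 * x) = ennreal (b - a) * (ennreal (b - a) * ennreal x)" if "0 \<le> x" for x
    using a that by (simp add: power2_eq_square mult.assoc flip: ennreal_mult)
  have "emeasure M {\<omega>\<in>space M. K \<omega> \<noteq> 0 \<and> K \<omega> \<noteq> 1} \<le> ennreal (l\<^sup>2)"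
    using poisson_prob_ge_2[OF _ l(2) P] by (simp add: emeasure_eq_measure ennreal_leI)
  also have "\<dots> = (ennreal (b - a) * n) * (ennreal (b - a) * n)"
    using l by (simp add: power2_eq_square ennreal_mult flip: l(1))
  \<comment> \<open>One tail mass is kept for the final bound; the other is replaced using
    \<open>n_le\<close>.\<close>
  also have "\<dots> \<le> (ennreal (b - a) * n) * (ennreal (b - a) * (ennreal (1 / u) * m))"
    by (intro mult_left_mono n_le) auto
  also have "\<dots> = ennreal ((b - a)\<^sup>2 * (1 / u)) * m * n"
    using u by (subst sq) (auto simp: mult_ac)
  finally have E1: "emeasure M {\<omega>\<in>space M. K \<omega> \<noteq> 0 \<and> K \<omega> \<noteq> 1} \<le> \<dots>" .
  \<comment> \<open>The indicator of a positive count, written as a function of the count so that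
    \<open>indep_jump_counts\<close> applies.\<close>
  define g where "g k = (if k = 0 then 0 else 1 :: ennreal)" for k :: ennreal
  have [measurable]: "g \<in> borel_measurable borel" unfolding g_def by measurable
  have "(\<integral>\<^sup>+\<omega>. g (K \<omega>) \<partial>M) = (\<integral>\<^sup>+\<omega>. indicator {\<omega>\<in>space M. K \<omega> \<noteq> 0} \<omega> \<partial>M)"
    by (intro nn_integral_cong) (auto simp: g_def indicator_def)
  also have "\<dots> = emeasure M {\<omega>\<in>space M. K \<omega> \<noteq> 0}"
    by (rule nn_integral_indicator) measurable
  also have "\<dots> \<le> ennreal l"
    using poisson_prob_pos[OF _ l(2) P] by (simp add: emeasure_eq_measure ennreal_leI)
  finally have g_le: "(\<integral>\<^sup>+\<omega>. g (K \<omega>) \<partial>M) \<le> ennreal l" .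
  have "emeasure M {\<omega>\<in>space M. K \<omega> \<noteq> 0 \<and> ennreal c < Z \<omega>} \<le> ennreal (1 / c) * (\<integral>\<^sup>+\<omega>. g (K \<omega>) * Z \<omega> \<partial>M)"
  proof -
    have ge: "1 \<le> ennreal (1 / c) * z" if "ennreal c < z" for z
    proof -
      have "1 = ennreal (1 / c) * ennreal c" using c by (simp flip: ennreal_mult')
      also have "\<dots> \<le> ennreal (1 / c) * z" using that by (intro mult_left_mono) auto
      finally show ?thesis .
    qed
    have "emeasure M {\<omega>\<in>space M. K \<omega> \<noteq> 0 \<and> ennreal c < Z \<omega>} =
        (\<integral>\<^sup>+\<omega>. indicator {\<omega>\<in>space M. K \<omega> \<noteq> 0 \<and> ennreal c < Z \<omega>} \<omega> \<partial>M)"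
      by (subst nn_integral_indicator) auto
    also have "\<dots> \<le> (\<integral>\<^sup>+\<omega>. ennreal (1 / c) * (g (K \<omega>) * Z \<omega>) \<partial>M)"
      by (intro nn_integral_mono) (auto simp: g_def ge split: split_indicator)
    finally show ?thesis by (simp add: nn_integral_cmult)
  qed
  \<comment> \<open>This stands in for an independence statement about \<open>K\<close> and
    \<open>Z\<close>: a subset of \<open>D\<close> is disjoint from \<open>B\<close>, so its count
    is independent of \<open>K\<close>, and \<open>nn_integral_family_le\<close> passes from such
    counts to \<open>Z\<close>.\<close>
  also have "(\<integral>\<^sup>+\<omega>. g (K \<omega>) * Z \<omega> \<partial>M) \<le> ennreal l * (\<integral>\<^sup>+p\<in>D. ennreal \<bar>snd p\<bar> \<partial>\<Lambda>)"
    unfolding Z_def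
  proof (rule nn_integral_family_le)
    fix C assume "C \<in> sets \<Lambda>" "C \<subseteq> D"
    then have C: "C \<in> sets (borel \<Otimes>\<^sub>M borel)" "B \<inter> C = {}"
      by (auto simp: sets_intensity B_def D_def)
    have "(\<integral>\<^sup>+\<omega>. g (K \<omega>) * emeasure (\<mu> \<omega>) C \<partial>M) = (\<integral>\<^sup>+\<omega>. g (K \<omega>) \<partial>M) * (\<integral>\<^sup>+\<omega>. emeasure (\<mu> \<omega>) C \<partial>M)"
      unfolding K_def using C by (intro indep_jump_counts) auto
    also have "\<dots> \<le> ennreal l * emeasure \<Lambda> C"
      by (intro mult_mono g_le nn_integral_jump_count_le C) auto
    finally show "(\<integral>\<^sup>+\<omega>. g (K \<omega>) * emeasure (\<mu> \<omega>) C \<partial>M) \<le> ennreal l * emeasure \<Lambda> C" .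
  qed (auto simp: sets_intensity sets_jump_measure measurable_cong_sets[OF sets_intensity refl])
  also have "(\<integral>\<^sup>+p\<in>D. ennreal \<bar>snd p\<bar> \<partial>\<Lambda>) \<le> ennreal (b - a) * m"
    unfolding D_def m_def using a by (intro nn_integral_intensity_le) auto
  finally have "emeasure M {\<omega>\<in>space M. K \<omega> \<noteq> 0 \<and> ennreal c < Z \<omega>} \<le>
      ennreal (1 / c) * (ennreal l * (ennreal (b - a) * m))"
    by (simp add: mult_left_mono)
  also have "\<dots> = ennreal ((b - a)\<^sup>2 * (1 / c)) * m * n"
    unfolding l(1) using c by (subst sq) (auto simp: mult_ac)
  finally have E2: "emeasure M {\<omega>\<in>space M. K \<omega> \<noteq> 0 \<and> ennreal c < Z \<omega>} \<le> \<dots>" .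
  have "emeasure M ((space M - no_large_jump M L a b u) \<inter> (space M - small_other_jumps M L a b c)) \<le>
      emeasure M ({\<omega>\<in>space M. K \<omega> \<noteq> 0 \<and> K \<omega> \<noteq> 1} \<union> {\<omega>\<in>space M. K \<omega> \<noteq> 0 \<and> ennreal c < Z \<omega>})"
    using large_and_other_jumps_subset[OF a, of u c] u
    by (intro emeasure_mono) (auto simp: K_def Z_def B_def[symmetric] D_def[symmetric])
  also have "\<dots> \<le> emeasure M {\<omega>\<in>space M. K \<omega> \<noteq> 0 \<and> K \<omega> \<noteq> 1} + emeasure M {\<omega>\<in>space M. K \<omega> \<noteq> 0 \<and> ennreal c < Z \<omega>}"
    by (intro emeasure_subadditive) auto
  also have "\<dots> \<le> ennreal ((b - a)\<^sup>2 * (1 / u)) * m * n + ennreal ((b - a)\<^sup>2 * (1 / c)) * m * n"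
    by (intro add_mono E1 E2)
  also have "\<dots> = ennreal ((b - a)\<^sup>2 * (1 / u + 1 / c)) * m * n"
    using u c by (simp add: distrib_left flip: distrib_right ennreal_plus)
  finally show ?thesis unfolding m_def n_def .
qed

end

section \<open>The estimate along the time grid\<close>

text \<open>Measurability of the events belongs to the conclusion because \<open>measure\<close> is
  0 on a non-measurable set, which would make the bound empty. The estimate for a general interval
  is applied between consecutive grid times, with \<open>u = 3 * v n / \<gamma>min\<close> and
  \<open>c = v n / \<gamma>max\<close>.\<close>

theorem lemma16:
  fixes M :: "'w measure"
    and \<Theta> :: "(real ^ 'd) set"
    and b :: "real ^ 'd \<Rightarrow> real \<Rightarrow> real"
    and \<sigma> \<gamma> :: "real \<Rightarrow> real"
    and W L :: "real \<Rightarrow> 'w \<Rightarrow> real"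
    and \<nu> :: "real measure"
    and X :: "real ^ 'd \<Rightarrow> real \<Rightarrow> 'w \<Rightarrow> real"
    and t :: "nat \<Rightarrow> nat \<Rightarrow> real"
    and \<Delta> v :: "nat \<Rightarrow> real"
    and \<epsilon> \<gamma>min \<gamma>max :: real
    and N A :: "nat \<Rightarrow> nat \<Rightarrow> 'w set"
  assumes prob_space: "prob_space M"
    and Theta: "compact \<Theta>"
    and W: "brownian_motion M W"
    and L: "pure_jump_levy M \<nu> L"
    and nu_abs: "(\<integral>\<^sup>+ z. ennreal \<bar>z\<bar> \<partial>\<nu>) < \<infinity>"
    and X: "\<And>\<theta>. \<theta> \<in> \<Theta> \<Longrightarrow> sde_solution M W L (b \<theta>) \<sigma> \<gamma> (X \<theta>)"
    and indep: "\<And>\<theta>. \<theta> \<in> \<Theta> \<Longrightarrow> independent_inputs M (X \<theta> 0) W L"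
    and t_0: "\<And>n. t n 0 = 0"
    and t_mono: "\<And>n i. i < n \<Longrightarrow> t n i \<le> t n (Suc i)"
    and Delta: "\<And>n. \<Delta> n = (SUP i\<in>{..<n}. t n (Suc i) - t n i)"
    and Delta_lim: "\<Delta> \<longlonglongrightarrow> 0"
    and t_lim: "filterlim (\<lambda>n. t n n) at_top sequentially"
    and n_Delta: "(\<lambda>n. real n * \<Delta> n) \<in> O(\<lambda>n. t n n)"
    and epsilon: "0 < \<epsilon>" "\<epsilon> < 1 / 2"
    and v: "\<And>n. v n = \<Delta> n powr (1 / 2 - \<epsilon>)"
    and lip: "\<exists>K. K-lipschitz_on UNIV \<sigma>" "\<exists>K. K-lipschitz_on UNIV \<gamma>"
      "\<exists>K. \<forall>\<theta>\<in>\<Theta>. K-lipschitz_on UNIV (b \<theta>)"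
    and dens: "\<And>\<theta>. \<theta> \<in> \<Theta> \<Longrightarrow> \<exists>s>0. \<exists>p :: real \<Rightarrow> real \<Rightarrow> real.
        (\<forall>x y. 0 \<le> p x y) \<and>
        (\<forall>x. \<exists>Y. sde_solution M W L (b \<theta>) \<sigma> \<gamma> Y \<and> (AE \<omega> in M. Y 0 \<omega> = x) \<and>
           distributed M lborel (Y s) (\<lambda>y. ennreal (p x y))) \<and>
        (\<forall>K. compact K \<longrightarrow> (\<exists>B. \<forall>x\<in>K. \<forall>y. p x y \<le> B))"
    and supp: "\<And>x c r. 0 < r \<Longrightarrow> \<exists>z\<in>measure_support \<nu>. \<gamma> x * z \<in> ball c r"
    and nu_moments: "\<And>q::real. 0 < q \<Longrightarrow> (\<integral>\<^sup>+ z\<in>{z. 1 < \<bar>z\<bar>}. ennreal (\<bar>z\<bar> powr q) \<partial>\<nu>) < \<infinity>"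
    and drift: "\<And>\<theta>. \<theta> \<in> \<Theta> \<Longrightarrow> \<exists>C>0. \<forall>\<^sub>F x in at_infinity. x * b \<theta> x \<le> - C * \<bar>x\<bar>\<^sup>2"
    and gamma_growth: "((\<lambda>x. \<bar>\<gamma> x\<bar> / \<bar>x\<bar>) \<longlongrightarrow> 0) at_infinity"
    and sigma_growth: "((\<lambda>x. \<bar>\<sigma> x\<bar> / \<bar>x\<bar>) \<longlongrightarrow> 0) at_infinity"
    and X0_moments: "\<And>\<theta> (q::real). \<theta> \<in> \<Theta> \<Longrightarrow> 0 < q \<Longrightarrow> integrable M (\<lambda>\<omega>. \<bar>X \<theta> 0 \<omega>\<bar> powr q)"
    and gamma_min: "\<gamma>min = (INF x. \<bar>\<gamma> x\<bar>)" "1 \<le> \<gamma>min"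
    and nu_small: "(\<integral>\<^sup>+ z\<in>{z. 0 < \<bar>z\<bar> \<and> \<bar>z\<bar> \<le> 1}. ennreal \<bar>z\<bar> \<partial>\<nu>) < \<infinity>"
    and nu_ac: "absolutely_continuous lborel \<nu>"
    and gamma_max: "\<gamma>max = (SUP x. \<bar>\<gamma> x\<bar>)" "bdd_above (range (\<lambda>x. \<bar>\<gamma> x\<bar>))"
    and N: "\<And>n i. N n i = no_large_jump M L (t n (i - 1)) (t n i) (3 * v n / \<gamma>min)"
    and A: "\<And>n i. A n i = small_other_jumps M L (t n (i - 1)) (t n i) (v n / \<gamma>max)"
  shows "(\<forall>n i. 1 \<le> i \<and> i \<le> n \<longrightarrow> N n i \<in> sets M \<and> A n i \<in> sets M) \<and>
    (\<exists>C>0. \<forall>n i. 1 \<le> i \<and> i \<le> n \<longrightarrow>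
       ennreal (measure M ((space M - N n i) \<inter> (space M - A n i)))
         \<le> ennreal (C * (\<Delta> n)\<^sup>2 / v n) * (\<integral>\<^sup>+ z\<in>{z. 3 * v n / \<gamma>min \<le> \<bar>z\<bar>}. 1 \<partial>\<nu>))"
proof -
  interpret summable_levy M \<nu> L
    using prob_space L nu_abs by (simp add: summable_levy_def summable_levy_axioms_def)
  define m where "m = enn2real (\<integral>\<^sup>+z. ennreal \<bar>z\<bar> \<partial>\<nu>)"
  have m: "(\<integral>\<^sup>+z. ennreal \<bar>z\<bar> \<partial>\<nu>) = ennreal m" "0 \<le> m"
    using nu_abs by (auto simp: m_def)
  have "\<gamma>min \<le> \<bar>\<gamma> 0\<bar>"
    unfolding gamma_min(1) by (rule cINF_lower) (auto intro!: bdd_belowI[of _ 0])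
  also have "\<bar>\<gamma> 0\<bar> \<le> \<gamma>max"
    unfolding gamma_max(1) by (rule cSUP_upper) (auto intro: gamma_max(2))
  finally have min_max: "\<gamma>min \<le> \<gamma>max" .
  have v_nonneg: "0 \<le> v n" for n by (simp add: v)
  have t_nonneg: "0 \<le> t n i" if "i \<le> n" for n i
    using that
  proof (induction i)
    case (Suc i)
    then show ?case using t_mono[of i n] by linarith
  qed (simp add: t_0)
  have pred_nonneg: "0 \<le> t n (i - 1)" if "i \<le> n" for n i
    using that by (intro t_nonneg) simp
  have step: "t n i - t n (i - 1) \<le> \<Delta> n" if "1 \<le> i" "i \<le> n" for n i
  proof -
    have "t n (Suc (i - 1)) - t n (i - 1) \<le> (SUP i\<in>{..<n}. t n (Suc i) - t n i)"
      using that by (intro cSUP_upper) auto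
    then show ?thesis using that by (simp add: Delta)
  qed
  \<comment> \<open>\<open>1 / u + 1 / c\<close> is at most \<open>2 * \<gamma>max / v n\<close>,
    and \<open>m\<close> is the first absolute moment of \<open>\<nu>\<close>; the added 1 yields
    \<open>0 < C\<close> from \<open>0 \<le> m\<close> alone.\<close>
  define C where "C = 2 * \<gamma>max * m + 1"
  have "0 < C" using m(2) min_max gamma_min(2) by (simp add: C_def add_nonneg_pos)
  have bound: "ennreal (measure M ((space M - N n i) \<inter> (space M - A n i)))
      \<le> ennreal (C * (\<Delta> n)\<^sup>2 / v n) * (\<integral>\<^sup>+ z\<in>{z. 3 * v n / \<gamma>min \<le> \<bar>z\<bar>}. 1 \<partial>\<nu>)"
    if i: "1 \<le> i" "i \<le> n" for n i
  proof (cases "t n (i - 1) < t n i")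
    \<comment> \<open>Grid times may coincide; then the interval is empty and the left side is 0.
      This also covers \<open>v n = 0\<close>, where the quotient has the default value 0.\<close>
    case False
    then have "N n i = space M" by (simp add: N no_large_jump_def)
    then show ?thesis by simp
  next
    case True
    define a where "a = t n (i - 1)"
    define b where "b = t n i"
    define u where "u = 3 * v n / \<gamma>min"
    define c where "c = v n / \<gamma>max"
    have ab: "0 \<le> a" "a < b" "b - a \<le> \<Delta> n"
      using True pred_nonneg[OF i(2)] step[OF i] by (auto simp: a_def b_def)
    \<comment> \<open>\<open>\<Delta> n\<close> is at least \<open>b - a\<close> and hence
      positive.\<close>
    then have "0 < v n" by (simp add: v)
    then have uc: "0 < u" "0 < c" using gamma_min(2) min_max by (auto simp: u_def c_def)
    \<comment> \<open>Here \<open>1 / u = \<gamma>min / (3 * v n)\<close>, and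
      \<open>\<gamma>min \<le> \<gamma>max\<close>.\<close>
    have "1 / u \<le> \<gamma>max / v n"
      using \<open>0 < v n\<close> gamma_min(2) min_max by (simp add: u_def field_simps)
    then have "1 / u + 1 / c \<le> 2 * \<gamma>max / v n"
      using \<open>0 < v n\<close> by (simp add: c_def)
    moreover have "(b - a)\<^sup>2 \<le> (\<Delta> n)\<^sup>2"
      using ab by (intro power_mono) auto
    ultimately have "(b - a)\<^sup>2 * (1 / u + 1 / c) * m \<le> (\<Delta> n)\<^sup>2 * (2 * \<gamma>max / v n) * m"
      using uc m(2) by (intro mult_right_mono mult_mono) auto
    also have "\<dots> \<le> C * (\<Delta> n)\<^sup>2 / v n"
      using \<open>0 < v n\<close> by (simp add: C_def field_simps)
    finally have coeff: "(b - a)\<^sup>2 * (1 / u + 1 / c) * m \<le> C * (\<Delta> n)\<^sup>2 / v n" .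
    have "ennreal (measure M ((space M - N n i) \<inter> (space M - A n i))) \<le>
        ennreal ((b - a)\<^sup>2 * (1 / u + 1 / c)) * ennreal m * emeasure \<nu> {z. u < \<bar>z\<bar>}"
      using large_and_other_jumps_le[OF ab(1,2) uc]
      by (simp add: N A a_def b_def u_def c_def m emeasure_eq_measure)
    also have "\<dots> \<le> ennreal (C * (\<Delta> n)\<^sup>2 / v n) * emeasure \<nu> {z. u \<le> \<bar>z\<bar>}"
    proof (intro mult_mono)
      show "ennreal ((b - a)\<^sup>2 * (1 / u + 1 / c)) * ennreal m \<le> ennreal (C * (\<Delta> n)\<^sup>2 / v n)"
        using coeff uc m(2) by (simp add: ennreal_leI flip: ennreal_mult)
      \<comment> \<open>The event concerns sizes strictly above \<open>u\<close>, the claimed bound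
        sizes of at least \<open>u\<close>.\<close>
      show "emeasure \<nu> {z. u < \<bar>z\<bar>} \<le> emeasure \<nu> {z. u \<le> \<bar>z\<bar>}"
        by (intro emeasure_mono) (auto simp: sets_nu)
    qed auto
    also have "emeasure \<nu> {z. u \<le> \<bar>z\<bar>} = (\<integral>\<^sup>+ z\<in>{z. u \<le> \<bar>z\<bar>}. 1 \<partial>\<nu>)"
      by (simp add: sets_nu)
    finally show ?thesis by (simp add: u_def)
  qed
  have "N n i \<in> sets M \<and> A n i \<in> sets M" if "1 \<le> i" "i \<le> n" for n i
    unfolding N A using pred_nonneg[OF that(2)] v_nonneg gamma_min(2)
    by (intro conjI sets_no_large_jump sets_small_other_jumps) auto
  then show ?thesis
    using \<open>0 < C\<close> bound by blast
qed

end
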